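(* Let $q$ be a power of a prime, let $\mathbb{F}_q$ be the field with $q$ elements and let $\overline{\mathbb{F}}_q$ be its algebraic closure. Let $Z=\mathbb{P}^3_{\mathbb{F}_q}\subseteq\mathbb{P}^3_{\overline{\mathbb{F}}_q}$ be the finite set of all $\mathbb{F}_q$-rational points. Then $Z$ is a $(q+1,q^2+1)$-geproci half grid; that is, $Z$ is $(q+1,q^2+1)$-geproci and $Z$ is a half grid.
   Context: Let $K$ be an algebraically closed field (here $K=\overline{\mathbb{F}}_q$). "General point" means any point of some nonempty Zariski open subset. Geproci: for positive integers $a\le b$, a finite set $Z\subseteq\mathbb{P}^3_K$ is $(a,b)$-geproci if, for a general point $P\in\mathbb{P}^3_K$, the image $\overline{Z}$ of $Z$ under projection from $P$ to a plane $H\cong\mathbb{P}^2_K$ (with $P\notin H$) is a complete intersection in $H$ of a curve of degree $a$ and a curve of degree $b$, i.e. the homogeneous ideal of the (reduced) set of points $\overline{Z}$ is generated by two forms of degrees $a$ and $b$ with no common factor. One writes $\{a,b\}$-geproci for the same notion when $a\le b$ is not required. Grid: given a set of $a$ pairwise disjoint lines and a set of $b$ pairwise disjoint lines in $\mathbb{P}^3_K$ such that every line of the first set meets every line of the second set transversely, the $ab$ points of intersection form an $(a,b)$-grid. A geproci set in $\mathbb{P}^3_K$ is called trivial if it is contained in a plane or is a grid, and nontrivial otherwise. Half grid: a set $Z\subseteq\mathbb{P}^3_K$ is a $\{\mu,\lambda\}$-half grid if $Z$ is a nontrivial $\{\mu,\lambda\}$-geproci set contained in a set of $\mu$ mutually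 skew lines, with each line containing $\lambda$ points of $Z$. A half grid is a $\{\mu,\lambda\}$-half grid for some $\mu,\lambda$. *)

theory Defs
  imports
    "HOL-Analysis.Analysis"
    "HOL-Algebra.Algebraic_Closure_Type"
    "HOL-Library.Poly_Mapping"
    "HOL-Number_Theory.Prime_Powers"
begin

section \<open>Projective space\<close>

text \<open>
  A point of the projective space of dimension \<open>CARD('n) - 1\<close> over \<open>'k\<close> is a
  one-dimensional linear subspace of \<open>'k ^ 'n\<close>; so \<open>('k, 4) proj\<close> is projective
  3-space and \<open>('k, 3) proj\<close> the projective plane.
\<close>

typedef (overloaded) ('k, 'n) proj =
  "{L :: ('k :: field ^ 'n :: finite) set. vec.subspace L \<and> vec.dim L = 1}"
proof -
  have "vec.dim (vec.span {axis undefined 1 :: 'k ^ 'n}) = 1"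
    by (subst vec.dim_span, subst vec.dim_eq_card_independent)
       (auto simp: axis_eq_0_iff vec.independent_insert)
  then show ?thesis
    by (intro exI[of _ "vec.span {axis undefined 1 :: 'k ^ 'n}"])
       (auto simp: vec.subspace_span)
qed

text \<open>The point with homogeneous coordinates \<open>v\<close>; meaningful for \<open>v \<noteq> 0\<close> only.\<close>

definition proj_point :: "'k :: field ^ 'n :: finite \<Rightarrow> ('k, 'n) proj" where
  "proj_point v = Abs_proj (vec.span {v})"

lemma Rep_proj_point:
  assumes "v \<noteq> 0"
  shows "Rep_proj (proj_point v) = vec.span {v}"
proof -
  have "vec.dim (vec.span {v}) = 1"
    using assms
    by (subst vec.dim_span, subst vec.dim_eq_card_independent)
       (auto simp: vec.independent_insert)
  then show ?thesis
    unfolding proj_point_def by (intro Abs_proj_inverse) (auto simp: vec.subspace_span)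
qed

definition linear_subvariety :: "nat \<Rightarrow> ('k :: field, 'n :: finite) proj set \<Rightarrow> bool" where
  "linear_subvariety d S \<longleftrightarrow>
     (\<exists>W. vec.subspace W \<and> vec.dim W = d + 1 \<and> S = {p. Rep_proj p \<subseteq> W})"

abbreviation proj_line :: "('k :: field, 'n :: finite) proj set \<Rightarrow> bool" where
  "proj_line \<equiv> linear_subvariety 1"

abbreviation proj_plane :: "('k :: field, 'n :: finite) proj set \<Rightarrow> bool" where
  "proj_plane \<equiv> linear_subvariety 2"

definition line_through ::
    "('k :: field, 'n :: finite) proj \<Rightarrow> ('k, 'n) proj \<Rightarrow> ('k, 'n) proj set" where
  "line_through p r = {s. Rep_proj s \<subseteq> vec.span (Rep_proj p \<union> Rep_proj r)}"

text \<open>The map on points induced by an injective linear map.\<close>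

definition proj_map ::
    "('k :: field ^ 'm :: finite \<Rightarrow> 'k ^ 'n :: finite) \<Rightarrow> ('k, 'm) proj \<Rightarrow> ('k, 'n) proj" where
  "proj_map \<phi> p = Abs_proj (\<phi> ` Rep_proj p)"


section \<open>Forms, homogeneous ideals and the Zariski topology\<close>

text \<open>
  Polynomials over \<open>'k\<close> in variables indexed by \<open>'n\<close>: a finitely supported function
  from exponent vectors to coefficients, with the convolution product.
\<close>

type_synonym ('k, 'n) mpoly = "('n \<Rightarrow>\<^sub>0 nat) \<Rightarrow>\<^sub>0 'k"

definition eval_mpoly :: "('k :: field, 'n :: finite) mpoly \<Rightarrow> 'k ^ 'n \<Rightarrow> 'k" where
  "eval_mpoly f x =
     (\<Sum>m\<in>Poly_Mapping.keys f. Poly_Mapping.lookup f m *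
        (\<Prod>i\<in>UNIV. (x $ i) ^ Poly_Mapping.lookup m i))"

text \<open>The zero polynomial is homogeneous of every degree.\<close>

definition homogeneous :: "nat \<Rightarrow> ('k :: field, 'n :: finite) mpoly \<Rightarrow> bool" where
  "homogeneous d f \<longleftrightarrow>
     (\<forall>m\<in>Poly_Mapping.keys f. (\<Sum>i\<in>UNIV. Poly_Mapping.lookup m i) = d)"

definition vanishes_at :: "('k :: field, 'n :: finite) mpoly \<Rightarrow> ('k, 'n) proj \<Rightarrow> bool" where
  "vanishes_at f p \<longleftrightarrow> (\<forall>v\<in>Rep_proj p. v \<noteq> 0 \<longrightarrow> eval_mpoly f v = 0)"

definition zariski_open :: "('k :: field, 'n :: finite) proj set \<Rightarrow> bool" where
  "zariski_open U \<longleftrightarrow>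
     (\<exists>F. (\<forall>f\<in>F. \<exists>d. homogeneous d f) \<and> - U = {p. \<forall>f\<in>F. vanishes_at f p})"

definition for_general_point :: "(('k :: field, 'n :: finite) proj \<Rightarrow> bool) \<Rightarrow> bool" where
  "for_general_point Q \<longleftrightarrow> (\<exists>U. zariski_open U \<and> U \<noteq> {} \<and> (\<forall>p\<in>U. Q p))"

text \<open>The ideal generated by a set is its span in the ring as a module over itself.\<close>

lemma module_times: "Modules.module ((*) :: 'a :: comm_ring_1 \<Rightarrow> 'a \<Rightarrow> 'a)"
  by unfold_locales (auto simp: algebra_simps)

definition ideal_generated :: "'a :: comm_ring_1 set \<Rightarrow> 'a set" where
  "ideal_generated = Modules.module.span (*)"

definition homogeneous_ideal ::
    "('k :: field, 'n :: finite) proj set \<Rightarrow> ('k, 'n) mpoly set" where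
  "homogeneous_ideal Z =
     ideal_generated {f. (\<exists>d. homogeneous d f) \<and> (\<forall>p\<in>Z. vanishes_at f p)}"

definition complete_intersection ::
    "nat \<Rightarrow> nat \<Rightarrow> ('k :: field, 3) proj set \<Rightarrow> bool" where
  "complete_intersection a b Z \<longleftrightarrow>
     (\<exists>f g. f \<noteq> 0 \<and> g \<noteq> 0 \<and> homogeneous a f \<and> homogeneous b g \<and>
        (\<forall>h. h dvd f \<and> h dvd g \<longrightarrow> h dvd 1) \<and>
        homogeneous_ideal Z = ideal_generated {f, g})"


section \<open>Geproci sets\<close>

text \<open>
  The projection of \<open>Z\<close> from \<open>P\<close> to a plane \<open>H\<close>. If \<open>P \<notin> H\<close> and \<open>P \<notin> Z\<close>, each
  line joining \<open>P\<close> to a point of \<open>Z\<close> meets \<open>H\<close> in exactly one point.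
\<close>

definition projection ::
    "('k :: field, 4) proj \<Rightarrow> ('k, 4) proj set \<Rightarrow> ('k, 4) proj set \<Rightarrow> ('k, 4) proj set" where
  "projection P H Z = (\<Union>Q\<in>Z. line_through P Q \<inter> H)"

text \<open>Identifications of a plane in projective 3-space with the projective plane.\<close>

definition plane_coordinates ::
    "('k :: field, 4) proj set \<Rightarrow> ('k ^ 3 \<Rightarrow> 'k ^ 4) \<Rightarrow> bool" where
  "plane_coordinates H \<phi> \<longleftrightarrow>
     Vector_Spaces.linear (*s) (*s) \<phi> \<and> inj \<phi> \<and> H = range (proj_map \<phi>)"

text \<open>
  The version in which the order of the two degrees is irrelevant. The condition
  \<open>P \<notin> Z\<close>, which holds for general \<open>P\<close>, makes the projection of \<open>Z\<close> defined.
\<close>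

definition geproci_unordered ::
    "nat \<Rightarrow> nat \<Rightarrow> ('k :: alg_closed_field, 4) proj set \<Rightarrow> bool" where
  "geproci_unordered a b Z \<longleftrightarrow>
     0 < a \<and> 0 < b \<and> finite Z \<and>
     for_general_point (\<lambda>P. P \<notin> Z \<and>
       (\<forall>H \<phi>. proj_plane H \<and> P \<notin> H \<and> plane_coordinates H \<phi> \<longrightarrow>
          complete_intersection a b (proj_map \<phi> -` projection P H Z)))"

definition geproci :: "nat \<Rightarrow> nat \<Rightarrow> ('k :: alg_closed_field, 4) proj set \<Rightarrow> bool" where
  "geproci a b Z \<longleftrightarrow> a \<le> b \<and> geproci_unordered a b Z"

text \<open>Two lines in 3-space meet transversely iff they have exactly one common point.\<close>

definition is_grid :: "nat \<Rightarrow> nat \<Rightarrow> ('k :: field, 4) proj set \<Rightarrow> bool" where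
  "is_grid a b Z \<longleftrightarrow>
     (\<exists>A B. finite A \<and> card A = a \<and> (\<forall>L\<in>A. proj_line L) \<and> pairwise disjnt A \<and>
        finite B \<and> card B = b \<and> (\<forall>M\<in>B. proj_line M) \<and> pairwise disjnt B \<and>
        (\<forall>L\<in>A. \<forall>M\<in>B. \<exists>p. L \<inter> M = {p}) \<and>
        Z = (\<Union>L\<in>A. \<Union>M\<in>B. L \<inter> M))"

definition trivial_config :: "('k :: field, 4) proj set \<Rightarrow> bool" where
  "trivial_config Z \<longleftrightarrow> (\<exists>H. proj_plane H \<and> Z \<subseteq> H) \<or> (\<exists>a b. is_grid a b Z)"

definition half_grid_of_type ::
    "nat \<Rightarrow> nat \<Rightarrow> ('k :: alg_closed_field, 4) proj set \<Rightarrow> bool" where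
  "half_grid_of_type \<mu> l Z \<longleftrightarrow>
     geproci_unordered \<mu> l Z \<and> \<not> trivial_config Z \<and>
     (\<exists>A. finite A \<and> card A = \<mu> \<and> (\<forall>L\<in>A. proj_line L) \<and> pairwise disjnt A \<and>
        Z \<subseteq> \<Union>A \<and> (\<forall>L\<in>A. card (L \<inter> Z) = l))"

definition half_grid :: "('k :: alg_closed_field, 4) proj set \<Rightarrow> bool" where
  "half_grid Z \<longleftrightarrow> (\<exists>\<mu> l. half_grid_of_type \<mu> l Z)"


section \<open>Rational points\<close>

text \<open>
  The points of projective space over the algebraic closure of \<open>'f\<close> having
  homogeneous coordinates in \<open>'f\<close>.
\<close>

definition rational_points :: "('f :: field alg_closure, 'n :: finite) proj set" where
  "rational_points = {proj_point v | v. v \<noteq> 0 \<and> (\<forall>i. v $ i \<in> range to_ac)}"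

end

theory Submission
  imports Defs "HOL-Library.Function_Algebras" "HOL-Number_Theory.Residues"
begin

no_notation fps_nth (infixl \<open>$\<close> 75)

text \<open>
  For a general vertex \<open>v\<close> the Frobenius conjugates \<open>v, v\<^sub>1, v\<^sub>2, v\<^sub>3\<close>, with \<open>v\<^sub>i = v\<^bsup>q^i\<^esup>\<close>, form a
  basis, by the nonvanishing of the Moore determinant. The cones \<open>det (x\<^sup>q, x, v, v\<^sub>1) = 0\<close> and
  \<open>det (x\<^sup>Q, x, v, v\<^sub>2) = 0\<close>, \<open>Q = q\<^sup>2\<close>, have vertex \<open>v\<close>, degrees \<open>q + 1\<close> and \<open>q\<^sup>2 + 1\<close>, and contain
  every rational point. Write \<open>x = a v + s v\<^sub>1 + t v\<^sub>2 + r v\<^sub>3\<close>. On the plane \<open>r = 0\<close>, which contains no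
  rational point, the two forms are up to constants \<open>t\<^bsup>q+1\<^esup>\<close> and \<open>s\<^bsup>q^2+1\<^esup>\<close> plus a multiple of
  \<open>t\<^bsup>q+1\<^esup>\<close>. So they are coprime, and modulo them every form is a combination of the monomials
  \<open>s\<^sup>i t\<^sup>j r\<^sup>k\<close> with \<open>i \<le> q\<^sup>2\<close>, \<open>j \<le> q\<close>; as there are exactly as many pairs \<open>(i, j)\<close> as points, a form
  vanishing on the projected points is congruent to \<open>0\<close>.

  The \<open>q\<^sup>2 + 1\<close> skew lines are those of a regular spread. The points are not a grid because a line
  has at most \<open>q + 1\<close> rational points, whereas \<open>(q + 1)\<^sup>2 < (q + 1) (q\<^sup>2 + 1)\<close>.
\<close>

section \<open>Polynomials as functions\<close>

definition mconst :: "'k \<Rightarrow> ('k :: field, 'n) mpoly" where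
  "mconst c = Poly_Mapping.single 0 c"

definition mvar :: "'n \<Rightarrow> ('k :: field, 'n) mpoly" where
  "mvar i = Poly_Mapping.single (Poly_Mapping.single i 1) 1"

lemma mconst_0 [simp]: "mconst 0 = 0"
  and mconst_1 [simp]: "mconst 1 = 1"
  and mconst_add: "mconst (c + d) = mconst c + mconst d"
  and mconst_mult: "mconst (c * d) = mconst c * mconst d"
  by (simp_all add: mconst_def single_add mult_single)

text \<open>The target ring and the coefficient map are left free: the field itself gives evaluation
  at a point, polynomials in one variable give restriction to a line and the grading substitution,
  and the polynomial ring gives back \<open>f\<close>.\<close>

definition meval ::
    "('k \<Rightarrow> 'r) \<Rightarrow> ('n \<Rightarrow> 'r) \<Rightarrow> ('k :: field, 'n :: finite) mpoly \<Rightarrow> 'r :: comm_ring_1" where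
  "meval c x f = (\<Sum>m\<in>Poly_Mapping.keys f. c (Poly_Mapping.lookup f m) *
     (\<Prod>i\<in>UNIV. x i ^ Poly_Mapping.lookup m i))"

lemma eval_mpoly_eq_meval: "eval_mpoly f v = meval (\<lambda>c. c) (vec_nth v) f"
  by (simp add: eval_mpoly_def meval_def)

lemma poly_mapping_sum_single:
  "f = (\<Sum>m\<in>Poly_Mapping.keys f. Poly_Mapping.single m (Poly_Mapping.lookup f m))"
proof (rule poly_mapping_eqI)
  fix k
  show "Poly_Mapping.lookup f k =
    Poly_Mapping.lookup (\<Sum>m\<in>Poly_Mapping.keys f. Poly_Mapping.single m (Poly_Mapping.lookup f m)) k"
    by (simp add: lookup_sum lookup_single when_def in_keys_iff)
qed

locale scalar_hom =
  fixes c :: "'k :: field \<Rightarrow> 'r :: comm_ring_1"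
  assumes hom_0: "c 0 = 0" and hom_1: "c 1 = 1"
    and hom_add: "c (a + b) = c a + c b" and hom_mult: "c (a * b) = c a * c b"
begin

lemma meval_superset:
  assumes "finite S" "Poly_Mapping.keys f \<subseteq> S"
  shows "meval c x f = (\<Sum>m\<in>S. c (Poly_Mapping.lookup f m) *
     (\<Prod>i\<in>UNIV. x i ^ Poly_Mapping.lookup m i))"
  unfolding meval_def using assms
  by (intro sum.mono_neutral_left) (auto simp: in_keys_iff hom_0)

lemma meval_add: "meval c x (f + g) = meval c x f + meval c x g"
proof -
  let ?S = "Poly_Mapping.keys f \<union> Poly_Mapping.keys g"
  have "Poly_Mapping.keys (f + g) \<subseteq> ?S"
    by (rule Poly_Mapping.keys_add)
  then show ?thesis
    by (simp add: meval_superset[of ?S] lookup_add hom_add distrib_right sum.distrib)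
qed

lemma meval_0 [simp]: "meval c x 0 = 0"
  by (simp add: meval_def)

lemma meval_sum: "meval c x (sum f A) = (\<Sum>a\<in>A. meval c x (f a))"
  by (induction A rule: infinite_finite_induct) (auto simp: meval_add)

lemma meval_single:
  "meval c x (Poly_Mapping.single m a) = c a * (\<Prod>i\<in>UNIV. x i ^ Poly_Mapping.lookup m i)"
  by (simp add: meval_superset[of "{m}"])

lemma meval_single_mult:
  "meval c x (Poly_Mapping.single m a * Poly_Mapping.single m' b) =
   meval c x (Poly_Mapping.single m a) * meval c x (Poly_Mapping.single m' b)"
  by (simp add: mult_single meval_single hom_mult lookup_add power_add prod.distrib mult_ac)

lemma meval_mult: "meval c x (f * g) = meval c x f * meval c x g"
proof -
  let ?s = "\<lambda>f m. Poly_Mapping.single m (Poly_Mapping.lookup f m)"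
  have "meval c x (f * g) = meval c x (\<Sum>m\<in>Poly_Mapping.keys f. \<Sum>m'\<in>Poly_Mapping.keys g. ?s f m * ?s g m')"
    by (subst poly_mapping_sum_single[of f], subst poly_mapping_sum_single[of g])
       (simp add: sum_product)
  also have "\<dots> = meval c x (\<Sum>m\<in>Poly_Mapping.keys f. ?s f m) * meval c x (\<Sum>m'\<in>Poly_Mapping.keys g. ?s g m')"
    unfolding meval_sum meval_single_mult sum_product ..
  finally show ?thesis
    by (simp flip: poly_mapping_sum_single)
qed

lemma meval_mconst [simp]: "meval c x (mconst a) = c a"
  by (simp add: mconst_def meval_single)

lemma meval_1 [simp]: "meval c x 1 = 1"
  using meval_mconst[of x 1] by (simp add: hom_1)

lemma meval_mvar [simp]: "meval c x (mvar i) = x i"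
proof -
  have "x j ^ (1 when i = j) = (if i = j then x j else 1)" for j
    by simp
  then show ?thesis
    by (simp add: mvar_def meval_single hom_1 lookup_single)
qed

lemma meval_power: "meval c x (f ^ n) = meval c x f ^ n"
  by (induction n) (auto simp: meval_mult)

lemma meval_prod: "meval c x (prod f A) = (\<Prod>a\<in>A. meval c x (f a))"
  by (induction A rule: infinite_finite_induct) (auto simp: meval_mult)

lemma meval_uminus: "meval c x (- f) = - meval c x f"
  using meval_add[of x f "- f"] by (simp add: eq_neg_iff_add_eq_0 add.commute)

lemma meval_diff: "meval c x (f - g) = meval c x f - meval c x g"
  using meval_add[of x f "- g"] by (simp add: meval_uminus)

end

interpretation scalar_id: scalar_hom "\<lambda>c :: 'k :: field. c"
  by standard auto

lemmas eval_mpoly_simps =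
  scalar_id.meval_add[where x = "vec_nth v" for v, folded eval_mpoly_eq_meval]
  scalar_id.meval_diff[where x = "vec_nth v" for v, folded eval_mpoly_eq_meval]
  scalar_id.meval_uminus[where x = "vec_nth v" for v, folded eval_mpoly_eq_meval]
  scalar_id.meval_mult[where x = "vec_nth v" for v, folded eval_mpoly_eq_meval]
  scalar_id.meval_power[where x = "vec_nth v" for v, folded eval_mpoly_eq_meval]
  scalar_id.meval_sum[where x = "vec_nth v" for v, folded eval_mpoly_eq_meval]
  scalar_id.meval_prod[where x = "vec_nth v" for v, folded eval_mpoly_eq_meval]
  scalar_id.meval_mconst[where x = "vec_nth v" for v, folded eval_mpoly_eq_meval]
  scalar_id.meval_mvar[where x = "vec_nth v" for v, folded eval_mpoly_eq_meval]
  scalar_id.meval_0[where x = "vec_nth v" for v, folded eval_mpoly_eq_meval]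
  scalar_id.meval_1[where x = "vec_nth v" for v, folded eval_mpoly_eq_meval]

lemma prod_mvar_power:
  "(\<Prod>i\<in>UNIV. mvar i ^ Poly_Mapping.lookup m i) =
     (Poly_Mapping.single m 1 :: ('k :: field, 'n :: finite) mpoly)"
proof -
  have pow: "mvar i ^ n = (Poly_Mapping.single (Poly_Mapping.single i n) 1 :: ('k, 'n) mpoly)"
    for i :: 'n and n
    by (induction n) (auto simp: mvar_def mult_single simp flip: single_add)
  have "(\<Prod>i\<in>A. (Poly_Mapping.single (g i) 1 :: ('k, 'n) mpoly)) = Poly_Mapping.single (sum g A) 1"
    if "finite A" for A :: "'n set" and g
    using that by induction (auto simp: mult_single)
  moreover have "(\<Sum>i\<in>UNIV. Poly_Mapping.single i (Poly_Mapping.lookup m i)) = m"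
    by (rule poly_mapping_eqI) (simp add: lookup_sum lookup_single when_def)
  ultimately show ?thesis
    by (simp add: pow)
qed

text \<open>Through this identity a claim about a form can be checked on monomials in the
  variables.\<close>

lemma meval_mconst_mvar: "meval mconst mvar f = f"
proof -
  have "mconst a * Poly_Mapping.single m 1 = Poly_Mapping.single m a" for m :: "'a \<Rightarrow>\<^sub>0 nat" and a :: 'b
    by (simp add: mconst_def mult_single)
  then have "meval mconst mvar f = (\<Sum>m\<in>Poly_Mapping.keys f. Poly_Mapping.single m (Poly_Mapping.lookup f m))"
    by (simp add: meval_def prod_mvar_power)
  then show ?thesis
    using poly_mapping_sum_single[of f] by simp
qed

section \<open>Homogeneous polynomials and their zeros\<close>

lemma homogeneous_0 [simp]: "homogeneous d 0"
  by (simp add: homogeneous_def)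

lemma homogeneous_add: "homogeneous d f \<Longrightarrow> homogeneous d g \<Longrightarrow> homogeneous d (f + g)"
  using Poly_Mapping.keys_add[of f g] by (auto simp: homogeneous_def)

lemma homogeneous_sum: "(\<And>a. a \<in> A \<Longrightarrow> homogeneous d (f a)) \<Longrightarrow> homogeneous d (sum f A)"
  by (induction A rule: infinite_finite_induct) (auto simp: homogeneous_add)

lemma homogeneous_mult:
  "homogeneous d f \<Longrightarrow> homogeneous e g \<Longrightarrow> homogeneous (d + e) (f * g)"
  using keys_mult[of f g] by (fastforce simp: homogeneous_def lookup_add sum.distrib)

lemma homogeneous_mconst: "homogeneous 0 (mconst c)"
  by (simp add: homogeneous_def mconst_def)

lemma homogeneous_mvar: "homogeneous 1 (mvar i)"
  by (auto simp: homogeneous_def mvar_def lookup_single when_def)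

lemma homogeneous_mconst_mult: "homogeneous d f \<Longrightarrow> homogeneous d (mconst c * f)"
  using homogeneous_mult[OF homogeneous_mconst] by fastforce

lemma homogeneous_uminus: "homogeneous d f \<Longrightarrow> homogeneous d (- f)"
  by (simp add: homogeneous_def in_keys_iff)

lemma homogeneous_diff: "homogeneous d f \<Longrightarrow> homogeneous d g \<Longrightarrow> homogeneous d (f - g)"
  using homogeneous_add[of d f "- g"] by (simp add: homogeneous_uminus)

lemma homogeneous_1: "homogeneous 0 1"
  using homogeneous_mconst[of 1] by simp

lemma homogeneous_power: "homogeneous d f \<Longrightarrow> homogeneous (d * n) (f ^ n)"
  by (induction n) (auto simp: homogeneous_1 dest: homogeneous_mult)

lemma homogeneous_prod:
  "(\<And>a. a \<in> A \<Longrightarrow> homogeneous (d a) (f a)) \<Longrightarrow> homogeneous (sum d A) (prod f A)"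
  by (induction A rule: infinite_finite_induct) (auto simp: homogeneous_1 homogeneous_mult)

lemma eval_mpoly_scale:
  assumes "homogeneous d f"
  shows "eval_mpoly f (c *s v) = c ^ d * eval_mpoly f v"
  unfolding eval_mpoly_def sum_distrib_left
proof (rule sum.cong)
  fix m assume "m \<in> Poly_Mapping.keys f"
  then have "d = (\<Sum>i\<in>UNIV. Poly_Mapping.lookup m i)"
    using assms by (auto simp: homogeneous_def)
  then show "Poly_Mapping.lookup f m * (\<Prod>i\<in>UNIV. (c *s v) $ i ^ Poly_Mapping.lookup m i) =
      c ^ d * (Poly_Mapping.lookup f m * (\<Prod>i\<in>UNIV. v $ i ^ Poly_Mapping.lookup m i))"
    by (simp add: power_mult_distrib prod.distrib power_sum)
qed simp

lemma Rep_proj_cases: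
  obtains v where "v \<noteq> 0" "Rep_proj p = vec.span {v}"
proof -
  have sub: "vec.subspace (Rep_proj p)" and dim: "vec.dim (Rep_proj p) = 1"
    using Rep_proj[of p] by auto
  then obtain B where B: "B \<subseteq> Rep_proj p" "vec.independent B" "Rep_proj p \<subseteq> vec.span B" "card B = 1"
    using vec.basis_exists by metis
  then obtain v where "B = {v}"
    by (meson card_1_singletonE)
  moreover have "vec.span B = Rep_proj p"
    using B sub vec.span_minimal by blast
  ultimately show ?thesis
    using B that by (metis vec.dependent_single)
qed

lemma vanishes_at_iff:
  assumes "homogeneous d f" "v \<noteq> 0" "Rep_proj p = vec.span {v}"
  shows "vanishes_at f p \<longleftrightarrow> eval_mpoly f v = 0"
  using assms by (auto simp: vanishes_at_def vec.span_singleton eval_mpoly_scale)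

text \<open>Substituting the affine functions \<open>v $ i + w $ i * X\<close> makes the restriction
  of \<open>f\<close> to a line a univariate polynomial, so that root counting and algebraic
  closedness apply to it.\<close>

lemma meval_poly_eval:
  "poly (meval (\<lambda>c. [:c:]) (\<lambda>i. [:v $ i, w $ i:]) f) x = eval_mpoly f (v + x *s w)"
  by (simp add: meval_def eval_mpoly_def poly_sum poly_prod)

text \<open>As in Euclid's argument on primes: over a finite field, one plus the product of all
  \<open>X - a\<close> is a nonconstant polynomial without a root.\<close>

lemma infinite_alg_closed: "infinite (UNIV :: 'k :: alg_closed_field set)"
proof
  assume fin: "finite (UNIV :: 'k set)"
  define p where "p = (\<Prod>a\<in>(UNIV :: 'k set). [:- a, 1:])"
  have "Polynomial.degree p = (\<Sum>a\<in>(UNIV :: 'k set). 1)"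
    unfolding p_def by (subst degree_prod_sum_eq) auto
  then have "Polynomial.degree (p + 1) = card (UNIV :: 'k set)"
    using fin by (subst degree_add_eq_left) (auto simp: card_gt_0_iff)
  then have "Polynomial.degree (p + 1) > 0"
    using fin by (simp add: card_gt_0_iff)
  then obtain x where "poly (p + 1) x = 0"
    using alg_closed_imp_poly_has_root by blast
  moreover have "poly p x = 0"
    using fin by (auto simp: p_def poly_prod)
  ultimately show False
    by simp
qed

text \<open>The restriction to the line is a univariate polynomial without roots, hence
  constant.\<close>

lemma eval_mpoly_const_on_line:
  fixes f :: "('k :: alg_closed_field, 'n :: finite) mpoly"
  assumes "\<And>x. eval_mpoly f (v + x *s w) \<noteq> 0"
  shows "eval_mpoly f (v + x *s w) = eval_mpoly f v"
proof -
  let ?p = "meval (\<lambda>c. [:c:]) (\<lambda>i. [:v $ i, w $ i:]) f"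
  have "Polynomial.degree ?p = 0"
    using alg_closed_imp_poly_has_root[of ?p] assms by (auto simp: meval_poly_eval)
  then obtain c where c: "?p = [:c:]"
    by (rule degree_eq_zeroE)
  have "eval_mpoly f (v + x *s w) = c" for x
    using c by (simp flip: meval_poly_eval)
  from this[of x] this[of 0] show ?thesis
    by simp
qed

section \<open>A criterion for complete intersections\<close>

lemma ideal_generated_pair: "x \<in> ideal_generated {f, g} \<longleftrightarrow> (\<exists>u v. x = u * f + v * g)"
proof -
  interpret Modules.module "(*) :: 'a \<Rightarrow> 'a \<Rightarrow> 'a"
    by (rule module_times)
  show ?thesis
    unfolding ideal_generated_def span_insert span_empty
    by (auto simp: algebra_simps diff_eq_eq)
qed

lemma ideal_generated_idem:
  assumes "f \<in> S" "g \<in> S" "S \<subseteq> ideal_generated {f, g}"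
  shows "ideal_generated S = ideal_generated {f, g}"
proof -
  interpret Modules.module "(*) :: 'a \<Rightarrow> 'a \<Rightarrow> 'a"
    by (rule module_times)
  show ?thesis
    using assms unfolding ideal_generated_def
    by (intro equalityI span_minimal span_mono subspace_span) auto
qed

lemma complete_intersection_commute: "complete_intersection a b Z \<Longrightarrow> complete_intersection b a Z"
proof -
  assume "complete_intersection a b Z"
  then obtain f g where fg: "f \<noteq> 0" "g \<noteq> 0" "homogeneous a f" "homogeneous b g"
    "\<forall>h. h dvd f \<and> h dvd g \<longrightarrow> h dvd 1" "homogeneous_ideal Z = ideal_generated {f, g}"
    unfolding complete_intersection_def by blast
  moreover have "{f, g} = {g, f}"
    by (rule insert_commute)
  ultimately show ?thesis
    unfolding complete_intersection_def by (intro exI[of _ g] exI[of _ f]) simp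
qed

text \<open>Scalars act through \<open>mconst\<close>, so \<open>mp.span\<close> is a span over the
  field, in contrast to \<open>ideal_generated\<close>, which is a span over the polynomial
  ring.\<close>

interpretation mp: vector_space "\<lambda>(c :: 'k :: field) f. (mconst c :: ('k, 'n) mpoly) * f"
  by standard (auto simp: mconst_add mconst_mult algebra_simps)

text \<open>A relation with \<open>d i0\<close> nonzero would eliminate \<open>e i0\<close>; then
  fewer than \<open>card Z\<close> functions would span all functions on \<open>Z\<close>, a space
  of dimension \<open>card Z\<close>.\<close>

lemma square_system_trivial:
  fixes e :: "'i \<Rightarrow> 'p \<Rightarrow> 'k :: field"
  assumes fin: "finite I" "finite Z" and card: "card I \<le> card Z"
    and span: "\<And>p. p \<in> Z \<Longrightarrow> \<exists>c. \<forall>p'\<in>Z. (\<Sum>i\<in>I. c i * e i p') = (if p' = p then 1 else 0)"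
    and zero: "\<And>p. p \<in> Z \<Longrightarrow> (\<Sum>i\<in>I. d i * e i p) = 0"
    and i0: "i0 \<in> I"
  shows "d i0 = 0"
proof (rule ccontr)
  assume d0: "d i0 \<noteq> 0"
  interpret fs: vector_space "\<lambda>(c :: 'k) (f :: 'p \<Rightarrow> 'k). (\<lambda>p. c * f p)"
    by standard (auto simp: fun_eq_iff algebra_simps)
  \<comment> \<open>Extension by 0 outside \<open>Z\<close> turns agreement on \<open>Z\<close> into
    equality of functions.\<close>
  define E where "E i = (\<lambda>p. if p \<in> Z then e i p else 0)" for i
  define \<delta> where "\<delta> p = (\<lambda>p'. if p' = p then (1 :: 'k) else 0)" for p :: 'p
  have "inj \<delta>"
    by (auto simp: inj_def \<delta>_def fun_eq_iff)
  then have inj: "inj_on \<delta> Z"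
    by (rule inj_on_subset) simp
  have sum_fun: "(\<Sum>i\<in>A. (\<lambda>p. u i * v i p)) = (\<lambda>p. \<Sum>i\<in>A. u i * v i p)"
    for A :: "'i set" and u :: "'i \<Rightarrow> 'k" and v :: "'i \<Rightarrow> 'p \<Rightarrow> 'k"
    by (induction A rule: infinite_finite_induct) (auto simp: fun_eq_iff)
  have sum_fun_point: "(\<Sum>i\<in>A. (\<lambda>p. u i * v i p)) = (\<lambda>p. \<Sum>i\<in>A. u i * v i p)"
    for A :: "'p set" and u :: "'p \<Rightarrow> 'k" and v :: "'p \<Rightarrow> 'p \<Rightarrow> 'k"
    by (induction A rule: infinite_finite_induct) (auto simp: fun_eq_iff)
  have indep: "fs.independent (\<delta> ` Z)"
  proof (subst fs.dependent_finite)
    show "\<not> (\<exists>u. (\<exists>v\<in>\<delta> ` Z. u v \<noteq> 0) \<and> (\<Sum>v\<in>\<delta> ` Z. (\<lambda>p. u v * v p)) = 0)"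
    proof safe
      fix u p assume p: "p \<in> Z" "u (\<delta> p) \<noteq> 0" and *: "(\<Sum>v\<in>\<delta> ` Z. (\<lambda>p. u v * v p)) = 0"
      have "(\<Sum>p'\<in>Z. (\<lambda>p. u (\<delta> p') * \<delta> p' p)) = 0"
        using * by (simp add: sum.reindex[OF inj])
      then have "(\<Sum>p'\<in>Z. u (\<delta> p') * \<delta> p' p) = 0"
        unfolding sum_fun_point by (simp add: fun_eq_iff)
      then show False
        using p fin by (simp add: \<delta>_def if_distrib cong: if_cong)
    qed
  qed (use fin in auto)
  have E_span: "E i \<in> fs.span (E ` (I - {i0}))" if "i \<in> I" for i
  proof (cases "i = i0")
    case True
    have "E i0 = (\<Sum>i\<in>I - {i0}. (\<lambda>p. (- d i / d i0) * E i p))"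
    proof
      fix p
      have "d i0 * E i0 p + (\<Sum>i\<in>I - {i0}. d i * E i p) = 0"
        using zero[of p] sum.remove[OF fin(1) i0, of "\<lambda>i. d i * E i p"]
        by (cases "p \<in> Z") (simp_all add: E_def)
      then have "E i0 p = - (\<Sum>i\<in>I - {i0}. d i * E i p) / d i0"
        using d0 by (simp add: field_simps eq_neg_iff_add_eq_0)
      also have "\<dots> = (\<Sum>i\<in>I - {i0}. (- d i / d i0) * E i p)"
        by (simp add: sum_divide_distrib sum_negf)
      finally have "E i0 p = (\<Sum>i\<in>I - {i0}. (- d i / d i0) * E i p)" .
      then show "E i0 p = (\<Sum>i\<in>I - {i0}. (\<lambda>p. (- d i / d i0) * E i p)) p"
        unfolding sum_fun .
    qed
    also have "\<dots> \<in> fs.span (E ` (I - {i0}))"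
      by (intro fs.span_sum fs.span_scale fs.span_base imageI)
    finally show ?thesis
      using True by simp
  qed (use that in \<open>auto intro: fs.span_base\<close>)
  have "\<delta> ` Z \<subseteq> fs.span (E ` (I - {i0}))"
  proof safe
    fix p assume p: "p \<in> Z"
    then obtain c where c: "\<forall>p'\<in>Z. (\<Sum>i\<in>I. c i * e i p') = (if p' = p then 1 else 0)"
      using span by blast
    have "\<delta> p = (\<Sum>i\<in>I. (\<lambda>p. c i * E i p))"
      unfolding sum_fun
    proof
      fix x
      show "\<delta> p x = (\<Sum>i\<in>I. c i * E i x)"
        using c p by (cases "x \<in> Z") (auto simp: \<delta>_def E_def)
    qed
    also have "\<dots> \<in> fs.span (E ` (I - {i0}))"
      by (intro fs.span_sum fs.span_scale E_span)
    finally show "\<delta> p \<in> fs.span (E ` (I - {i0}))" .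
  qed
  then have "card (\<delta> ` Z) \<le> card (E ` (I - {i0}))"
    by (intro conjunct2[OF fs.independent_span_bound[OF _ indep]]) (use fin in auto)
  also have "\<dots> \<le> card (I - {i0})"
    using fin by (intro card_image_le) auto
  also have "\<dots> < card I"
    using i0 fin by (intro psubset_card_mono) auto
  finally show False
    using card inj by (simp add: card_image)
qed

text \<open>The product vanishes at 0 to order \<open>n\<close>, and all of this order falls on
  \<open>q\<close>. So \<open>q\<close> has degree at least \<open>n\<close>, and no degree is left
  for \<open>p\<close>.\<close>

lemma monom_factor_const:
  fixes p q :: "'a :: idom poly"
  assumes "p * q = Polynomial.monom c n" "c \<noteq> 0" "poly p 0 \<noteq> 0"
  shows "Polynomial.degree p = 0"
proof -
  have nz: "p * q \<noteq> 0"
    using assms by (simp add: monom_eq_0_iff)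
  then have [simp]: "p \<noteq> 0" "q \<noteq> 0"
    by auto
  have "n = Polynomial.order 0 (p * q)"
    using assms by simp
  also have "\<dots> = Polynomial.order 0 q"
    using assms(3) nz by (simp add: order_mult order_0I)
  also have "\<dots> \<le> Polynomial.degree q"
    by (rule order_degree) simp
  finally have "n \<le> Polynomial.degree q" .
  moreover have "Polynomial.degree p + Polynomial.degree q = n"
    using assms degree_mult_eq[of p q] by (simp add: degree_monom_eq)
  ultimately show ?thesis
    by simp
qed

lemma mconst_sum: "mconst (sum g A) = (\<Sum>a\<in>A. mconst (g a))"
  by (induction A rule: infinite_finite_induct) (auto simp: mconst_add)

lemma mconst_prod: "mconst (prod g A) = (\<Prod>a\<in>A. mconst (g a))"
  by (induction A rule: infinite_finite_induct) (auto simp: mconst_mult)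

lemma mconst_power: "mconst (x ^ n) = mconst x ^ n"
  by (induction n) (auto simp: mconst_mult)

lemma mconst_eq_0_iff [simp]: "mconst c = 0 \<longleftrightarrow> c = 0"
  by (metis mconst_def lookup_single_eq lookup_zero mconst_0)

lemma mconst_eval_mpoly: "mconst (eval_mpoly f v) = meval mconst (\<lambda>i. mconst (v $ i)) f"
  by (simp add: eval_mpoly_def meval_def mconst_sum mconst_prod mconst_power mconst_mult)

lemma prod_monom:
  "(\<Prod>i\<in>A. Polynomial.monom (c i) (n i)) = Polynomial.monom (\<Prod>i\<in>A. c i) (\<Sum>i\<in>A. n i)"
  by (induction A rule: infinite_finite_induct) (auto simp: mult_monom monom_0 one_pCons)

lemma sum_monom:
  "(\<Sum>i\<in>A. Polynomial.monom (c i) n) = Polynomial.monom (\<Sum>i\<in>A. c i) n"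
  by (induction A rule: infinite_finite_induct) (auto simp: add_monom)

text \<open>
  The grading is recorded by the substitution \<open>X\<^sub>i \<mapsto> X\<^sub>i T\<close>, which sends a form of degree \<open>d\<close>
  to a monomial of degree \<open>d\<close> in \<open>T\<close>.
\<close>

lemma homogeneous_factor_const:
  fixes h :: "('k :: field, 'n :: {finite, linorder}) mpoly"
  assumes "homogeneous d f" "f \<noteq> 0" "h dvd f" "eval_mpoly h 0 \<noteq> 0"
  shows "h dvd 1"
proof -
  define \<Phi> :: "('k, 'n) mpoly \<Rightarrow> ('k, 'n) mpoly poly"
    where "\<Phi> = meval (\<lambda>c. [:mconst c:]) (\<lambda>i. Polynomial.monom (mvar i) 1)"
  interpret \<Phi>: scalar_hom "\<lambda>c :: 'k. [:mconst c :: ('k, 'n) mpoly:]"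
    by standard (auto simp: mconst_add mconst_mult one_pCons)
  \<comment> \<open>Setting T = 1 recovers the polynomial, and T = 0 leaves its constant
    term.\<close>
  have "poly (\<Phi> g) 1 = meval mconst mvar g" for g
    by (simp add: \<Phi>_def meval_def poly_sum poly_prod poly_monom)
  then have \<Phi>_1: "poly (\<Phi> g) 1 = g" for g
    by (simp only: meval_mconst_mvar)
  have \<Phi>_0: "poly (\<Phi> g) 0 = mconst (eval_mpoly g 0)" for g
    by (simp add: \<Phi>_def mconst_eval_mpoly meval_def poly_sum poly_prod poly_monom)
  obtain k where k: "f = h * k"
    using assms by blast
  have "\<Phi> f = (\<Sum>m\<in>Poly_Mapping.keys f. Polynomial.monom (mconst (Poly_Mapping.lookup f m) *
      (\<Prod>i\<in>UNIV. mvar i ^ Poly_Mapping.lookup m i)) d)"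
    unfolding \<Phi>_def meval_def
  proof (rule sum.cong)
    fix m assume "m \<in> Poly_Mapping.keys f"
    then have "(\<Sum>i\<in>UNIV. Poly_Mapping.lookup m i) = d"
      using assms(1) by (simp add: homogeneous_def)
    then show "[:mconst (Poly_Mapping.lookup f m):] *
        (\<Prod>i\<in>UNIV. Polynomial.monom (mvar i) 1 ^ Poly_Mapping.lookup m i) =
        Polynomial.monom (mconst (Poly_Mapping.lookup f m) * (\<Prod>i\<in>UNIV. mvar i ^ Poly_Mapping.lookup m i)) d"
      by (simp add: monom_power prod_monom smult_monom)
  qed simp
  also have "\<dots> = Polynomial.monom (meval mconst mvar f) d"
    by (simp add: meval_def sum_monom)
  finally have "\<Phi> f = Polynomial.monom f d"
    by (simp only: meval_mconst_mvar)
  then have "\<Phi> h * \<Phi> k = Polynomial.monom f d"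
    unfolding k by (simp add: \<Phi>_def \<Phi>.meval_mult)
  moreover have "poly (\<Phi> h) 0 \<noteq> 0"
    using assms(4) by (simp add: \<Phi>_0)
  \<comment> \<open>Orders and degrees add up because the coefficient ring is a domain; this is
    where the linear order on the indices \<open>'n\<close> enters.\<close>
  ultimately have "Polynomial.degree (\<Phi> h) = 0"
    using assms(2) monom_factor_const by blast
  then have "poly (\<Phi> h) 1 = poly (\<Phi> h) 0"
    by (metis degree_eq_zeroE poly_const_conv)
  then have "h = mconst (eval_mpoly h 0)"
    by (simp add: \<Phi>_0 \<Phi>_1)
  moreover have "mconst c dvd (1 :: ('k, 'n) mpoly)" if "c \<noteq> 0" for c
    by (rule dvdI[of _ _ "mconst (inverse c)"]) (simp add: that flip: mconst_mult)
  ultimately show ?thesis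
    using assms(4) by metis
qed

text \<open>A monomial of degree 1 is a single variable, which is a linear function of the
  point.\<close>

lemma eval_mpoly_linear:
  fixes f :: "('k :: field, 'n :: finite) mpoly"
  assumes "homogeneous 1 f"
  shows "eval_mpoly f (x *s u + y *s w) = x * eval_mpoly f u + y * eval_mpoly f w"
  unfolding eval_mpoly_def sum_distrib_left sum.distrib[symmetric]
proof (rule sum.cong)
  fix m assume "m \<in> Poly_Mapping.keys f"
  then have "(\<Sum>i\<in>UNIV. Poly_Mapping.lookup m i) = Suc 0"
    using assms by (simp add: homogeneous_def)
  then obtain i where i: "Poly_Mapping.lookup m i = 1" "\<And>j. i \<noteq> j \<Longrightarrow> Poly_Mapping.lookup m j = 0"
    using sum_eq_Suc0_iff[OF finite, of "Poly_Mapping.lookup m" UNIV] by auto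
  have monom: "(\<Prod>j\<in>UNIV. v $ j ^ Poly_Mapping.lookup m j) = v $ i" for v :: "'k ^ 'n"
    using i by (subst prod.remove[of _ i]) auto
  then show "Poly_Mapping.lookup f m * (\<Prod>i\<in>UNIV. (x *s u + y *s w) $ i ^ Poly_Mapping.lookup m i) =
      x * (Poly_Mapping.lookup f m * (\<Prod>i\<in>UNIV. u $ i ^ Poly_Mapping.lookup m i)) +
      y * (Poly_Mapping.lookup f m * (\<Prod>i\<in>UNIV. w $ i ^ Poly_Mapping.lookup m i))"
    unfolding monom by (simp add: algebra_simps)
qed simp

section \<open>Forms in three independent linear forms\<close>

text \<open>A linear change of coordinates of the plane: \<open>mvar_span\<close> rewrites every
  form in terms of \<open>s\<close>, \<open>t\<close>, \<open>r\<close> and separates vectors, and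
  \<open>surj\<close> supplies vectors with prescribed coordinates.\<close>

locale linear_coordinates =
  fixes s t r :: "('k :: alg_closed_field, 3) mpoly"
  assumes hom: "homogeneous 1 s" "homogeneous 1 t" "homogeneous 1 r"
    and mvar_span: "\<And>i. mvar i \<in> mp.span {s, t, r}"
    and surj: "\<And>x y z. \<exists>v. eval_mpoly s v = x \<and> eval_mpoly t v = y \<and> eval_mpoly r v = z"
begin

text \<open>By \<open>homogeneous_imp_forms\<close> and \<open>forms_imp_homogeneous\<close> these
  are exactly the homogeneous polynomials of degree \<open>d\<close>, presented in the monomials on
  which the reduction modulo the two equations operates.\<close>

definition forms :: "nat \<Rightarrow> ('k, 3) mpoly set" where
  "forms d = mp.span {s ^ i * t ^ j * r ^ k | i j k. i + j + k = d}"

lemma monomial_forms: "i + j + k = d \<Longrightarrow> s ^ i * t ^ j * r ^ k \<in> forms d"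
  unfolding forms_def by (intro mp.span_base) auto

lemma forms_linear:
  "0 \<in> forms d" "x \<in> forms d \<Longrightarrow> y \<in> forms d \<Longrightarrow> x + y \<in> forms d"
  "x \<in> forms d \<Longrightarrow> mconst c * x \<in> forms d"
  unfolding forms_def by (auto intro: mp.span_zero mp.span_add mp.span_scale)

lemma span_mult:
  assumes x: "x \<in> mp.span A" and y: "y \<in> mp.span B"
    and AB: "\<And>a b. a \<in> A \<Longrightarrow> b \<in> B \<Longrightarrow> a * b \<in> mp.span C"
  shows "x * y \<in> mp.span C"
  using x
proof (induction rule: mp.span_induct_alt)
  case (step c a z)
  have "a * y \<in> mp.span C"
    using y
  proof (induction rule: mp.span_induct_alt)
    case (step c' b z')
    then have "mconst c' * (a * b) + a * z' \<in> mp.span C"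
      using \<open>a \<in> A\<close> AB by (intro mp.span_add mp.span_scale)
    then show ?case
      by (simp add: algebra_simps)
  qed (auto intro: mp.span_zero)
  then have "mconst c * (a * y) + z * y \<in> mp.span C"
    using step by (intro mp.span_add mp.span_scale)
  then show ?case
    by (simp add: algebra_simps)
qed (auto intro: mp.span_zero)

lemma forms_mult:
  assumes "x \<in> forms d" "y \<in> forms e"
  shows "x * y \<in> forms (d + e)"
  using assms unfolding forms_def
proof (rule span_mult)
  fix x y assume "x \<in> {s ^ i * t ^ j * r ^ k | i j k. i + j + k = d}"
    and "y \<in> {s ^ i * t ^ j * r ^ k | i j k. i + j + k = e}"
  then obtain i j k i' j' k' where "x = s ^ i * t ^ j * r ^ k" "y = s ^ i' * t ^ j' * r ^ k'"
    "i + j + k = d" "i' + j' + k' = e"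
    by blast
  then have "x * y = s ^ (i + i') * t ^ (j + j') * r ^ (k + k')" "(i + i') + (j + j') + (k + k') = d + e"
    by (auto simp: power_add mult_ac)
  then show "x * y \<in> mp.span {s ^ i * t ^ j * r ^ k | i j k. i + j + k = d + e}"
    by (intro mp.span_base) blast
qed

lemma forms_1: "1 \<in> forms 0"
  using monomial_forms[of 0 0 0 0] by simp

lemma forms_power: "x \<in> forms d \<Longrightarrow> x ^ n \<in> forms (d * n)"
  by (induction n) (auto simp: forms_1 dest: forms_mult)

lemma forms_prod: "(\<And>a. a \<in> A \<Longrightarrow> f a \<in> forms (d a)) \<Longrightarrow> prod f A \<in> forms (sum d A)"
  by (induction A rule: infinite_finite_induct) (auto simp: forms_1 forms_mult)

lemma homogeneous_imp_forms:
  assumes "homogeneous d h"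
  shows "h \<in> forms d"
proof -
  have "{s, t, r} \<subseteq> forms 1"
    using monomial_forms[of 1 0 0 1] monomial_forms[of 0 1 0 1] monomial_forms[of 0 0 1 1] by simp
  then have "mp.span {s, t, r} \<subseteq> forms 1"
    unfolding forms_def by (rule mp.span_minimal) (rule mp.subspace_span)
  then have var: "mvar i \<in> forms 1" for i
    using mvar_span by blast
  have "meval mconst mvar h \<in> forms d"
    unfolding meval_def forms_def
  proof (rule mp.span_sum, rule mp.span_scale)
    fix m assume "m \<in> Poly_Mapping.keys h"
    \<comment> \<open>The factor 1 is the degree of \<open>mvar i\<close>; it matches the degree
      \<open>d * n\<close> in \<open>forms_power\<close>.\<close>
    then have "(\<Sum>i\<in>UNIV. 1 * Poly_Mapping.lookup m i) = d"
      using assms by (simp add: homogeneous_def)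
    then show "(\<Prod>i\<in>UNIV. mvar i ^ Poly_Mapping.lookup m i) \<in>
        mp.span {s ^ i * t ^ j * r ^ k | i j k. i + j + k = d}"
      using forms_prod[of UNIV "\<lambda>i. mvar i ^ Poly_Mapping.lookup m i" "\<lambda>i. 1 * Poly_Mapping.lookup m i"]
        forms_power[OF var] by (auto simp: forms_def)
  qed
  then show ?thesis
    by (simp only: meval_mconst_mvar)
qed

lemma homogeneous_monomial: "homogeneous (i + j + k) (s ^ i * t ^ j * r ^ k)"
  using homogeneous_power[OF hom(1), of i] homogeneous_power[OF hom(2), of j]
    homogeneous_power[OF hom(3), of k] by (intro homogeneous_mult) auto

lemma forms_imp_homogeneous:
  assumes "h \<in> forms d"
  shows "homogeneous d h"
  using assms unfolding forms_def
proof (induction rule: mp.span_induct_alt)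
  case (step c x y)
  then show ?case
    using homogeneous_monomial by (auto intro!: homogeneous_add homogeneous_mconst_mult)
qed auto

lemma coordinates_inj:
  assumes "eval_mpoly s v = eval_mpoly s w" "eval_mpoly t v = eval_mpoly t w"
    "eval_mpoly r v = eval_mpoly r w"
  shows "v = w"
proof -
  have "eval_mpoly x v = eval_mpoly x w" if "x \<in> mp.span {s, t, r}" for x
    using that
    by (induction rule: mp.span_induct_alt) (use assms in \<open>auto simp: eval_mpoly_simps\<close>)
  from this[OF mvar_span] show ?thesis
    by (simp add: eval_mpoly_simps vec_eq_iff)
qed

end

text \<open>Modulo \<open>r\<close> the two forms are \<open>t ^ a\<close> and
  \<open>s ^ b + t ^ a * B\<close>; thus the two curves do not meet on the line
  \<open>r = 0\<close>.\<close>

locale ci_equations = linear_coordinates s t r for s t r :: "('k :: alg_closed_field, 3) mpoly" +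
  fixes a b :: nat and A B C F G :: "('k, 3) mpoly"
  assumes ab: "0 < a" "a \<le> b"
    and forms_ABC: "A \<in> forms (a - 1)" "B \<in> forms (b - a)" "C \<in> forms (b - 1)"
    and F_def: "F = t ^ a + r * A" and G_def: "G = s ^ b + t ^ a * B + r * C"
begin

lemma homogeneous_F: "homogeneous a F"
  using homogeneous_mult[OF hom(3) forms_imp_homogeneous[OF forms_ABC(1)]]
    homogeneous_power[OF hom(2), of a] ab by (simp add: F_def homogeneous_add)

lemma homogeneous_G: "homogeneous b G"
  using homogeneous_mult[OF hom(3) forms_imp_homogeneous[OF forms_ABC(3)]]
    homogeneous_mult[OF homogeneous_power[OF hom(2), of a] forms_imp_homogeneous[OF forms_ABC(2)]]
    homogeneous_power[OF hom(1), of b] ab by (simp add: G_def homogeneous_add)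

section \<open>The ideal of the two equations and normal forms modulo it\<close>

definition J where "J = ideal_generated {F, G}"

lemma J_iff: "x \<in> J \<longleftrightarrow> (\<exists>u v. x = u * F + v * G)"
  unfolding J_def by (rule ideal_generated_pair)

lemma J_mult: "x \<in> J \<Longrightarrow> y * x \<in> J"
proof -
  assume "x \<in> J"
  then obtain u v where "x = u * F + v * G"
    unfolding J_iff by blast
  then have "y * x = (y * u) * F + (y * v) * G"
    by (simp add: algebra_simps)
  then show ?thesis
    unfolding J_iff by blast
qed

lemma F_in_J: "F \<in> J"
  unfolding J_iff by (intro exI[of _ 1] exI[of _ 0]) simp

lemma G_in_J: "G \<in> J"
  unfolding J_iff by (rule exI[of _ 0], rule exI[of _ 1]) simp

lemma zero_in_J: "0 \<in> J"
  unfolding J_iff by (intro exI[of _ 0]) simp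

lemma J_add: "x \<in> J \<Longrightarrow> y \<in> J \<Longrightarrow> x + y \<in> J"
proof -
  assume "x \<in> J" "y \<in> J"
  then obtain u v u' v' where "x = u * F + v * G" "y = u' * F + v' * G"
    unfolding J_iff by blast
  then have "x + y = (u + u') * F + (v + v') * G"
    by (simp add: algebra_simps)
  then show ?thesis
    unfolding J_iff by blast
qed

text \<open>All of \<open>J\<close> is adjoined, not only its part of degree \<open>d\<close>;
  membership then means congruence modulo \<open>J\<close> to a combination of box monomials of
  degree \<open>d\<close>.\<close>

definition reduced :: "nat \<Rightarrow> ('k, 3) mpoly set" where
  "reduced d = mp.span (J \<union> {s ^ i * t ^ j * r ^ k | i j k. i < b \<and> j < a \<and> i + j + k = d})"

lemma J_reduced: "x \<in> J \<Longrightarrow> x \<in> reduced d"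
  unfolding reduced_def by (rule mp.span_base) simp

lemma reduced_diff: "x \<in> reduced d \<Longrightarrow> y \<in> reduced d \<Longrightarrow> x - y \<in> reduced d"
  unfolding reduced_def by (rule mp.span_diff)

text \<open>The box bounds only the exponents of \<open>s\<close> and \<open>t\<close>, which
  multiplication by \<open>r\<close> leaves unchanged.\<close>

lemma r_mult_reduced:
  assumes "x \<in> reduced d"
  shows "r * x \<in> reduced (Suc d)"
  using assms unfolding reduced_def
proof (induction rule: mp.span_induct_alt)
  case base
  then show ?case by (simp add: mp.span_zero)
next
  case (step c x y)
  have "r * x \<in> reduced (Suc d)"
  proof (cases "x \<in> J")
    case False
    then obtain i j k where "x = s ^ i * t ^ j * r ^ k" "i < b" "j < a" "i + j + k = d"
      using step by blast
    then have "r * x = s ^ i * t ^ j * r ^ Suc k" "i < b \<and> j < a \<and> i + j + Suc k = Suc d"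
      by auto
    then show ?thesis
      unfolding reduced_def by (intro mp.span_base) blast
  qed (auto intro: J_reduced J_mult)
  then have "mconst c * (r * x) + r * y \<in> reduced (Suc d)"
    using step unfolding reduced_def by (intro mp.span_add mp.span_scale)
  then show ?case
    by (simp add: reduced_def algebra_simps)
qed

text \<open>
  Modulo \<open>r\<close> the ideal contains \<open>t\<^sup>a\<close> and \<open>s\<^sup>b\<close>, so a monomial outside the box is congruent to
  \<open>r\<close> times a form of smaller degree.
\<close>

lemma forms_reduced: "forms d \<subseteq> reduced d"
proof (induction d rule: less_induct)
  case (less d)
  have r_forms: "r * x \<in> reduced d" if "x \<in> forms (d - 1)" "0 < d" for x
    using less[of "d - 1"] r_mult_reduced[of x "d - 1"] that by auto
  \<comment> \<open>Modulo \<open>F\<close> the form \<open>t ^ a * x\<close> equals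
    \<open>- r * (x * A)\<close>, and \<open>x * A\<close> has smaller degree.\<close>
  have ta: "t ^ a * x \<in> reduced d" if x: "x \<in> forms e" "e + a = d" for x e
  proof -
    have "x * A \<in> forms (e + (a - 1))"
      by (rule forms_mult) (use x forms_ABC in auto)
    then have "r * (x * A) \<in> reduced d"
      using x ab by (intro r_forms) auto
    then have "x * F - r * (x * A) \<in> reduced d"
      by (rule reduced_diff[OF J_reduced[OF J_mult[OF F_in_J]]])
    then show ?thesis
      by (simp add: F_def algebra_simps)
  qed
  have "s ^ i * t ^ j * r ^ k \<in> reduced d" if d: "i + j + k = d" for i j k
  proof (cases "0 < k")
    case True
    have "s ^ i * t ^ j * r ^ (k - 1) \<in> forms (d - 1)"
      by (rule monomial_forms) (use d True in auto)
    then have "r * (s ^ i * t ^ j * r ^ (k - 1)) \<in> reduced d"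
      using d True by (intro r_forms) auto
    moreover have "r ^ k = r * r ^ (k - 1)"
      using True by (cases k) auto
    ultimately show ?thesis
      by (simp add: mult_ac)
  next
    case k: False
    consider "a \<le> j" | "j < a" "b \<le> i" | "j < a" "i < b"
      by linarith
    then show ?thesis
    proof cases
      case 1
      have "s ^ i * t ^ (j - a) * r ^ 0 \<in> forms (i + (j - a))"
        by (rule monomial_forms) simp
      then have "t ^ a * (s ^ i * t ^ (j - a) * r ^ 0) \<in> reduced d"
        by (rule ta) (use 1 d k in auto)
      moreover have "t ^ j = t ^ a * t ^ (j - a)"
        using 1 by (simp flip: power_add)
      ultimately show ?thesis
        using k by (simp add: mult_ac)
    next
      \<comment> \<open>Modulo \<open>G\<close> the factor \<open>s ^ b\<close> becomes
        \<open>- t ^ a * B - r * C\<close>; \<open>ta\<close> handles the first term and the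
        induction hypothesis the second.\<close>
      case 2
      let ?x = "s ^ (i - b) * t ^ j * r ^ 0"
      have x: "?x \<in> forms (i - b + j)"
        by (rule monomial_forms) simp
      have "?x * C \<in> forms (i - b + j + (b - 1))"
        by (rule forms_mult[OF x forms_ABC(3)])
      then have "r * (?x * C) \<in> reduced d"
        using 2 ab d k by (intro r_forms) auto
      moreover have "t ^ a * (?x * B) \<in> reduced d"
        by (rule ta[OF forms_mult[OF x forms_ABC(2)]]) (use 2 ab d k in auto)
      ultimately have "?x * G - t ^ a * (?x * B) - r * (?x * C) \<in> reduced d"
        by (rule reduced_diff[OF reduced_diff[OF J_reduced[OF J_mult[OF G_in_J]]], rotated])
      moreover have "s ^ i = s ^ b * s ^ (i - b)"
        using 2 by (simp flip: power_add)
      ultimately show ?thesis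
        using k by (simp add: G_def algebra_simps)
    next
      case 3
      then show ?thesis
        using d unfolding reduced_def by (intro mp.span_base) blast
    qed
  qed
  then have "{s ^ i * t ^ j * r ^ k | i j k. i + j + k = d} \<subseteq> reduced d"
    by blast
  then show ?case
    unfolding forms_def reduced_def by (rule mp.span_minimal) (rule mp.subspace_span)
qed

text \<open>The sum runs over the same box for every \<open>d\<close>, so that forms of all degrees
  share one set of \<open>a * b\<close> coefficients. For \<open>i + j > d\<close> the truncated
  exponent of \<open>r\<close> is 0, but the coefficients built in the proof are 0 there.\<close>

lemma reduced_normal_form:
  assumes "h \<in> reduced d"
  shows "\<exists>c. h - (\<Sum>(i, j)\<in>{..<b} \<times> {..<a}. mconst (c (i, j)) * (s ^ i * t ^ j * r ^ (d - i - j))) \<in> J"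
    (is "\<exists>c. h - ?S c \<in> J")
proof -
  have S: "?S (\<lambda>x. c * u x + v x) = mconst c * ?S u + ?S v" for c u v
    by (simp only: sum_distrib_left split_def mconst_add mconst_mult distrib_right sum.distrib mult.assoc)
  have base: "\<exists>u. x - ?S u \<in> J" if "x \<in> J \<union> {s ^ i * t ^ j * r ^ k | i j k. i < b \<and> j < a \<and> i + j + k = d}" for x
  proof (cases "x \<in> J")
    case True
    then show ?thesis
      by (intro exI[of _ "\<lambda>_. 0"]) simp
  next
    case False
    then obtain i j k where x: "x = s ^ i * t ^ j * r ^ k" "i < b" "j < a" "i + j + k = d"
      using \<open>x \<in> _\<close> by blast
    have "?S (\<lambda>x. if x = (i, j) then 1 else 0) =
        (\<Sum>x\<in>{..<b} \<times> {..<a}. if x = (i, j) then s ^ i * t ^ j * r ^ (d - i - j) else 0)"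
      by (intro sum.cong) (simp_all split: prod.splits)
    also have "\<dots> = x"
      using x by auto
    finally show ?thesis
      by (intro exI[of _ "\<lambda>x. if x = (i, j) then 1 else 0"]) (simp add: zero_in_J)
  qed
  show ?thesis
    using assms unfolding reduced_def
  proof (induction rule: mp.span_induct_alt)
    case base
    then show ?case
      by (intro exI[of _ "\<lambda>_. 0"]) (simp add: zero_in_J)
  next
    case (step c x y)
    obtain u where "x - ?S u \<in> J"
      using base[OF step(1)] by blast
    moreover obtain v where "y - ?S v \<in> J"
      using step by blast
    ultimately have "mconst c * (x - ?S u) + (y - ?S v) \<in> J"
      by (intro J_add J_mult)
    then have "mconst c * x + y - ?S (\<lambda>x. c * u x + v x) \<in> J"
      by (simp only: S right_diff_distrib add_diff_add)
    then show ?case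
      by (rule exI[of _ "\<lambda>x. c * u x + v x"])
  qed
qed

lemma J_eval:
  assumes "x \<in> J" "eval_mpoly F v = 0" "eval_mpoly G v = 0"
  shows "eval_mpoly x v = 0"
  using assms by (auto simp: J_iff eval_mpoly_simps)

text \<open>
  A common divisor has no zero on the line \<open>r = 0\<close>, hence none on that plane through the origin
  of affine space except possibly the origin itself; over an algebraically closed field this
  excludes the origin as well.
\<close>

lemma coprime_FG:
  assumes "h dvd F" "h dvd G"
  shows "h dvd 1"
proof -
  obtain e\<^sub>s where es: "eval_mpoly s e\<^sub>s = 1" "eval_mpoly t e\<^sub>s = 0" "eval_mpoly r e\<^sub>s = 0"
    using surj by blast
  obtain e\<^sub>t where et: "eval_mpoly s e\<^sub>t = 0" "eval_mpoly t e\<^sub>t = 1" "eval_mpoly r e\<^sub>t = 0"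
    using surj by blast
  have lin: "eval_mpoly l (x *s e\<^sub>s + y *s e\<^sub>t) = x * eval_mpoly l e\<^sub>s + y * eval_mpoly l e\<^sub>t"
    if "homogeneous 1 l" for l x y
    using that by (rule eval_mpoly_linear)
  \<comment> \<open>On \<open>r = 0\<close> a common zero of \<open>F\<close> and \<open>G\<close>
    satisfies \<open>t ^ a = 0\<close>, then \<open>s ^ b = 0\<close>, so both coordinates
    vanish.\<close>
  have nz: "eval_mpoly h (x *s e\<^sub>s + y *s e\<^sub>t) \<noteq> 0" if "x \<noteq> 0 \<or> y \<noteq> 0" for x y
  proof
    let ?v = "x *s e\<^sub>s + y *s e\<^sub>t"
    assume "eval_mpoly h ?v = 0"
    then have "eval_mpoly F ?v = 0" "eval_mpoly G ?v = 0"
      using assms by (auto elim!: dvdE simp: eval_mpoly_simps)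
    moreover have "eval_mpoly s ?v = x" "eval_mpoly t ?v = y" "eval_mpoly r ?v = 0"
      using lin[OF hom(1)] lin[OF hom(2)] lin[OF hom(3)] es et by auto
    ultimately show False
      using that ab by (auto simp: F_def G_def eval_mpoly_simps power_0_left)
  qed
  \<comment> \<open>The two families of lines used next miss the origin, so \<open>h\<close> is
    constant on each of them. A line of the second family meets the first one, which carries the
    value \<kappa> to every nonzero multiple of the first basis vector.\<close>
  define \<kappa> where "\<kappa> = eval_mpoly h e\<^sub>t"
  have on_line: "eval_mpoly h (e\<^sub>t + x *s e\<^sub>s) = \<kappa>" for x
    unfolding \<kappa>_def using nz[of _ 1] by (intro eval_mpoly_const_on_line) (simp add: add.commute)
  have through_0: "eval_mpoly h (x *s e\<^sub>s + y *s e\<^sub>t) = eval_mpoly h (x *s e\<^sub>s)" if "x \<noteq> 0" for x y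
    using nz[of x] that by (intro eval_mpoly_const_on_line) simp
  have const: "eval_mpoly h (x *s e\<^sub>s) = \<kappa>" if "x \<noteq> 0" for x
    using that through_0[of x 1] on_line[of x] by (simp add: add.commute)
  let ?p = "meval (\<lambda>c. [:c:]) (\<lambda>i. [:0, e\<^sub>s $ i:]) h - [:\<kappa>:]"
  have p_eval: "poly ?p x = eval_mpoly h (x *s e\<^sub>s) - \<kappa>" for x
    using meval_poly_eval[of 0 e\<^sub>s h x] by simp
  \<comment> \<open>On the line through the origin, \<open>h\<close> minus \<kappa> vanishes at
    infinitely many parameters, hence also at 0.\<close>
  have "UNIV - {0} \<subseteq> {x. poly ?p x = 0}"
    using const by (auto simp: p_eval simp del: poly_diff)
  then have "infinite {x. poly ?p x = 0}"
    using infinite_alg_closed[where ?'k = 'k] by (meson finite_subset finite_Diff2 finite.emptyI finite_insert)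
  then have "?p = 0"
    using poly_roots_finite by blast
  then have "eval_mpoly h 0 = \<kappa>"
    using p_eval[of 0] by simp
  moreover have "\<kappa> \<noteq> 0"
    using nz[of 0 1] by (simp add: \<kappa>_def)
  moreover have eval_F: "eval_mpoly F e\<^sub>t = 1"
    by (simp add: F_def eval_mpoly_simps et)
  moreover have "F \<noteq> 0"
    using eval_F by (auto simp: eval_mpoly_simps)
  ultimately show ?thesis
    using homogeneous_factor_const homogeneous_F assms(1) by metis
qed

text \<open>
  The \<open>a b\<close> reduced monomials span all functions on the \<open>a b\<close> points, hence are linearly
  independent as functions, and a form vanishing on the points has normal form \<open>0\<close>.
\<close>

lemma complete_intersection:
  assumes fin: "finite Z" and card: "card Z = a * b"
    and van: "\<And>p. p \<in> Z \<Longrightarrow> vanishes_at F p" "\<And>p. p \<in> Z \<Longrightarrow> vanishes_at G p"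
    and r: "\<And>p. p \<in> Z \<Longrightarrow> \<not> vanishes_at r p"
  shows "complete_intersection a b Z"
proof -
  \<comment> \<open>Representatives are normalised by \<open>r = 1\<close>; the powers of
    \<open>r\<close> then disappear from the values of the normal form, and with them its dependence
    on the degree.\<close>
  have "\<exists>v. v \<noteq> 0 \<and> Rep_proj p = vec.span {v} \<and> eval_mpoly r v = 1" if p: "p \<in> Z" for p
  proof -
    obtain v where v: "v \<noteq> 0" "Rep_proj p = vec.span {v}"
      by (rule Rep_proj_cases)
    then have nz: "eval_mpoly r v \<noteq> 0"
      using r[OF p] vanishes_at_iff[OF hom(3)] by blast
    let ?w = "inverse (eval_mpoly r v) *s v"
    have "eval_mpoly r ?w = 1"
      using nz by (simp add: eval_mpoly_scale[OF hom(3)])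
    moreover have "?w \<noteq> 0" "Rep_proj p = vec.span {?w}"
      using v nz vec.span_image_scale[of "{v}" "\<lambda>_. inverse (eval_mpoly r v)"] by auto
    ultimately show ?thesis
      by blast
  qed
  then obtain v where v: "\<And>p. p \<in> Z \<Longrightarrow> v p \<noteq> 0"
    "\<And>p. p \<in> Z \<Longrightarrow> Rep_proj p = vec.span {v p}" "\<And>p. p \<in> Z \<Longrightarrow> eval_mpoly r (v p) = 1"
    by metis
  have van_iff: "vanishes_at h p \<longleftrightarrow> eval_mpoly h (v p) = 0" if "p \<in> Z" "homogeneous d h" for p h d
    using vanishes_at_iff that v by blast
  have F0: "eval_mpoly F (v p) = 0" and G0: "eval_mpoly G (v p) = 0" if "p \<in> Z" for p
    using van van_iff that homogeneous_F homogeneous_G by blast+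
  let ?I = "{..<b} \<times> {..<a}"
  define e where "e = (\<lambda>(i, j) p. eval_mpoly s (v p) ^ i * eval_mpoly t (v p) ^ j)"
  have normal_form: "\<exists>c. (\<forall>p\<in>Z. eval_mpoly h (v p) = (\<Sum>x\<in>?I. c x * e x p)) \<and>
      ((\<forall>x\<in>?I. c x = 0) \<longrightarrow> h \<in> J)" if h: "homogeneous d h" for h d
  proof -
    have "h \<in> reduced d"
      using h homogeneous_imp_forms forms_reduced by blast
    then obtain c where c: "h - (\<Sum>(i, j)\<in>?I. mconst (c (i, j)) * (s ^ i * t ^ j * r ^ (d - i - j))) \<in> J"
      using reduced_normal_form by blast
    have "eval_mpoly h (v p) = (\<Sum>x\<in>?I. c x * e x p)" if p: "p \<in> Z" for p
    proof -
      have "eval_mpoly (h - (\<Sum>(i, j)\<in>?I. mconst (c (i, j)) * (s ^ i * t ^ j * r ^ (d - i - j)))) (v p) = 0"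
        using c F0[OF p] G0[OF p] by (rule J_eval)
      then have "eval_mpoly h (v p) = (\<Sum>x\<in>?I. eval_mpoly (case x of (i, j) \<Rightarrow> mconst (c (i, j)) * (s ^ i * t ^ j * r ^ (d - i - j))) (v p))"
        by (simp add: eval_mpoly_simps)
      also have "\<dots> = (\<Sum>x\<in>?I. c x * e x p)"
        by (intro sum.cong) (auto simp: eval_mpoly_simps e_def v(3)[OF p])
      finally show ?thesis .
    qed
    moreover have "h \<in> J" if "\<forall>x\<in>?I. c x = 0"
    proof -
      have "(\<Sum>(i, j)\<in>?I. mconst (c (i, j)) * (s ^ i * t ^ j * r ^ (d - i - j))) = 0"
        using that by (intro sum.neutral) auto
      then show ?thesis
        using c by simp
    qed
    ultimately show ?thesis
      by blast
  qed
  have separate: "\<exists>l. homogeneous 1 l \<and> eval_mpoly l (v p') = 0 \<and> eval_mpoly l (v p) = 1"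
    if p: "p \<in> Z" "p' \<in> Z" "p' \<noteq> p" for p p'
  proof -
    have "v p \<noteq> v p'"
      using v(2) p by (metis Rep_proj_inject)
    then have "\<exists>m\<in>{s, t}. eval_mpoly m (v p) \<noteq> eval_mpoly m (v p')"
      using coordinates_inj[of "v p" "v p'"] v(3) p by auto
    then obtain m where m: "homogeneous 1 m" "eval_mpoly m (v p) \<noteq> eval_mpoly m (v p')"
      using hom by blast
    \<comment> \<open>This is a line through \<open>p'\<close> that misses \<open>p\<close>: as
      \<open>r\<close> is 1 at both representatives, subtracting a multiple of \<open>r\<close>
      shifts the value of \<open>m\<close>.\<close>
    define l where "l = mconst (inverse (eval_mpoly m (v p) - eval_mpoly m (v p'))) * (m - mconst (eval_mpoly m (v p')) * r)"
    have "homogeneous 1 l"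
      unfolding l_def by (intro homogeneous_mconst_mult homogeneous_diff m hom)
    moreover have "eval_mpoly l (v p') = 0" "eval_mpoly l (v p) = 1"
      using m v(3) p by (auto simp: l_def eval_mpoly_simps)
    ultimately show ?thesis
      by blast
  qed
  have interpolation: "\<exists>c. \<forall>p'\<in>Z. (\<Sum>x\<in>?I. c x * e x p') = (if p' = p then 1 else 0)" if p: "p \<in> Z" for p
  proof -
    obtain l where l: "\<And>p'. p' \<in> Z - {p} \<Longrightarrow> homogeneous 1 (l p') \<and> eval_mpoly (l p') (v p') = 0 \<and> eval_mpoly (l p') (v p) = 1"
      using separate[OF p] by (metis DiffD1 DiffD2 singletonI)
    \<comment> \<open>The degree of this product of lines is one less than \<open>card Z\<close>;
      that is harmless because the box \<open>?I\<close> serves every degree.\<close>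
    define h where "h = (\<Prod>p'\<in>Z - {p}. l p')"
    have "homogeneous (\<Sum>p'\<in>Z - {p}. 1) h"
      unfolding h_def using l by (intro homogeneous_prod) auto
    then obtain c where "\<forall>p\<in>Z. eval_mpoly h (v p) = (\<Sum>x\<in>?I. c x * e x p)"
      using normal_form by blast
    moreover have "eval_mpoly h (v p') = (if p' = p then 1 else 0)" if "p' \<in> Z" for p'
      using l fin that by (auto simp: h_def eval_mpoly_simps)
    ultimately show ?thesis
      by metis
  qed
  have ideal: "h \<in> J" if h: "homogeneous d h" "\<forall>p\<in>Z. vanishes_at h p" for h d
  proof -
    obtain c where c: "\<forall>p\<in>Z. eval_mpoly h (v p) = (\<Sum>x\<in>?I. c x * e x p)"
      "(\<forall>x\<in>?I. c x = 0) \<longrightarrow> h \<in> J"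
      using normal_form[OF h(1)] by blast
    have "c x = 0" if "x \<in> ?I" for x
    proof (rule square_system_trivial[of ?I Z e c])
      show "card ?I \<le> card Z"
        using card by (simp add: mult.commute)
      show "(\<Sum>x\<in>?I. c x * e x p) = 0" if "p \<in> Z" for p
        using c(1) h van_iff that by metis
    qed (use fin interpolation that in auto)
    then show ?thesis
      using c(2) by blast
  qed
  have "homogeneous_ideal Z = ideal_generated {F, G}"
    unfolding homogeneous_ideal_def
  proof (rule ideal_generated_idem)
    show "{f. (\<exists>d. homogeneous d f) \<and> (\<forall>p\<in>Z. vanishes_at f p)} \<subseteq> ideal_generated {F, G}"
      using ideal by (auto simp: J_def)
  qed (use homogeneous_F homogeneous_G van in auto)
  moreover obtain u w where "eval_mpoly s u = 0 \<and> eval_mpoly t u = 1 \<and> eval_mpoly r u = 0"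
    "eval_mpoly s w = 1 \<and> eval_mpoly t w = 0 \<and> eval_mpoly r w = 0"
    using surj by meson
  then have "eval_mpoly F u = 1" "eval_mpoly G w = 1"
    using ab by (auto simp: F_def G_def eval_mpoly_simps power_0_left)
  then have "F \<noteq> 0" "G \<noteq> 0"
    by (auto simp: eval_mpoly_simps)
  ultimately show ?thesis
    unfolding complete_intersection_def
    using homogeneous_F homogeneous_G coprime_FG by blast
qed

end

section \<open>The Frobenius map\<close>

definition frob :: "'f :: {field, finite} alg_closure \<Rightarrow> 'f alg_closure" where
  "frob x = x ^ CARD('f)"

definition vfrob :: "'f :: {field, finite} alg_closure ^ 'n \<Rightarrow> 'f alg_closure ^ 'n" where
  "vfrob v = (\<chi> i. frob (v $ i))"

lemma CARD_field_ge_2: "2 \<le> CARD('f :: {field, finite})"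
  using card_mono[of "UNIV :: 'f set" "{0, 1}"] by simp

lemma frob_mult: "frob (x * y) = frob x * frob y"
  by (simp add: frob_def power_mult_distrib)

lemma frob_0 [simp]: "frob (0 :: 'f :: {field, finite} alg_closure) = 0"
  using CARD_field_ge_2[where ?'f = 'f] by (simp add: frob_def power_0_left)

lemma frob_1 [simp]: "frob 1 = 1"
  by (simp add: frob_def)

lemma frob_eq_0_iff [simp]: "frob (x :: 'f :: {field, finite} alg_closure) = 0 \<longleftrightarrow> x = 0"
  using CARD_field_ge_2[where ?'f = 'f] by (simp add: frob_def)

text \<open>Multiplication by a nonzero \<open>x\<close> permutes the nonzero elements; comparing
  their products before and after gives the claim.\<close>

lemma finite_field_fermat: "(x :: 'f :: {field, finite}) ^ CARD('f) = x"
proof (cases "x = 0")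
  case True
  then show ?thesis
    using CARD_field_ge_2[where ?'f = 'f] by (simp add: power_0_left)
next
  case False
  have "bij_betw ((*) x) (UNIV - {0}) (UNIV - {0})"
    using False by (intro bij_betwI[of _ _ _ "\<lambda>y. y / x"]) auto
  then have "(\<Prod>y\<in>UNIV - {0}. x * y) = \<Prod>(UNIV - {0})"
    by (rule prod.reindex_bij_betw)
  then have "x ^ card (UNIV - {0 :: 'f}) * \<Prod>(UNIV - {0}) = \<Prod>(UNIV - {0 :: 'f})"
    by (simp add: prod.distrib)
  moreover have "\<Prod>(UNIV - {0 :: 'f}) \<noteq> 0"
    by (simp add: prod_zero_iff)
  ultimately have "x ^ card (UNIV - {0 :: 'f}) = 1"
    by simp
  moreover have "CARD('f) = Suc (card (UNIV - {0 :: 'f}))"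
    using card.remove[of UNIV "0 :: 'f"] by simp
  ultimately show ?thesis
    by (simp only: power_Suc mult_1_right)
qed

lemma frob_to_ac [simp]: "frob (to_ac x) = to_ac x"
  by (simp add: frob_def finite_field_fermat flip: to_ac_power)

text \<open>All these elements are roots of some \<open>X ^ m - X\<close>. Finiteness for higher
  powers of q later provides an element moved by the first three powers of the Frobenius
  map.\<close>

lemma finite_roots_frobenius:
  "0 < n \<Longrightarrow> finite {x :: 'f :: {field, finite} alg_closure. x ^ (CARD('f) ^ n) = x}"
  and card_roots_frobenius: "card {x :: 'f :: {field, finite} alg_closure. frob x = x} \<le> CARD('f)"
proof -
  have *: "finite {x. poly (Polynomial.monom 1 m - [:0, 1 :: 'f alg_closure:]) x = 0} \<and>
    card {x. poly (Polynomial.monom 1 m - [:0, 1 :: 'f alg_closure:]) x = 0} \<le> m" if "2 \<le> m" for m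
  proof -
    have "Polynomial.degree (Polynomial.monom 1 m - [:0, 1 :: 'f alg_closure:]) = m"
      unfolding diff_conv_add_uminus using that
      by (subst degree_add_eq_left) (auto simp: degree_monom_eq)
    moreover from this have "Polynomial.monom 1 m - [:0, 1 :: 'f alg_closure:] \<noteq> 0"
      using that by auto
    ultimately show ?thesis
      using poly_roots_finite card_poly_roots_bound by metis
  qed
  show "finite {x :: 'f alg_closure. x ^ (CARD('f) ^ n) = x}" if "0 < n"
  proof -
    have "CARD('f) ^ 1 \<le> CARD('f) ^ n"
      using that by (intro power_increasing) auto
    then have "2 \<le> CARD('f) ^ n"
      using CARD_field_ge_2[where ?'f = 'f] by simp
    from *[OF this] show ?thesis
      by (simp add: poly_monom)
  qed
  show "card {x :: 'f alg_closure. frob x = x} \<le> CARD('f)"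
    using *[OF CARD_field_ge_2[where ?'f = 'f]] by (simp add: poly_monom frob_def)
qed

text \<open>The base field consists of fixed elements and already has q of them, the largest
  possible number of roots of \<open>X ^ q - X\<close>.\<close>

lemma frob_eq_self_iff: "frob x = x \<longleftrightarrow> x \<in> range to_ac"
proof -
  have fin: "finite {x :: 'a alg_closure. frob x = x}"
    using finite_roots_frobenius[of 1, where ?'f = 'a] by (simp add: frob_def)
  have "range to_ac \<subseteq> {x :: 'a alg_closure. frob x = x}"
    by auto
  moreover have "card (range to_ac :: 'a alg_closure set) = CARD('a)"
    by (rule card_image) (rule inj_to_ac)
  ultimately have "range to_ac = {x :: 'a alg_closure. frob x = x}"
    using card_roots_frobenius[where ?'f = 'a] by (intro card_seteq[OF fin]) simp_all
  then show ?thesis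
    by blast
qed

lemma vfrob_eq_self_iff: "vfrob v = v \<longleftrightarrow> (\<forall>i. v $ i \<in> range to_ac)"
  by (simp add: vfrob_def vec_eq_iff frob_eq_self_iff)

lemma vfrob_scale: "vfrob (c *s v) = frob c *s vfrob v"
  by (simp add: vfrob_def vec_eq_iff frob_mult)

locale finite_base_field =
  fixes F :: "'f :: {field, finite} itself"
  assumes primepow_CARD: "primepow CARD('f)"
begin

text \<open>The characteristic divides the order of the field, so q is a power of it, and the
  freshman's dream applies.\<close>

lemma frob_add: "frob (x + y :: 'f alg_closure) = frob x + frob y"
proof -
  obtain p n where p: "Factorial_Ring.prime p" "CARD('f) = p ^ n"
    using primepow_CARD by (auto simp: primepow_def)
  have prime: "Factorial_Ring.prime CHAR('f)"
    by (rule prime_CHAR_semidom) (simp add: finite_imp_CHAR_pos)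
  have "CHAR('f) dvd p ^ n"
    using CHAR_dvd_CARD[where ?'a = 'f] p by simp
  then have "CHAR('f) = p"
    using p prime by (meson prime_dvd_power primes_dvd_imp_eq)
  then show ?thesis
    unfolding frob_def using p prime by (intro freshmans_dream'[of _ n]) auto
qed

lemma frob_uminus: "frob (- x :: 'f alg_closure) = - frob x"
  using frob_add[of x "- x"] by (simp add: eq_neg_iff_add_eq_0 add.commute)

lemma frob_diff: "frob (x - y :: 'f alg_closure) = frob x - frob y"
  using frob_add[of x "- y"] by (simp add: frob_uminus)

lemma frob_eq_iff: "frob x = frob y \<longleftrightarrow> x = (y :: 'f alg_closure)"
  using frob_eq_0_iff[of "x - y"] by (simp add: frob_diff)

lemma vfrob_add: "vfrob (v + w :: 'f alg_closure ^ 'n) = vfrob v + vfrob w"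
  by (simp add: vfrob_def vec_eq_iff frob_add)

end

section \<open>Lines and their rational points\<close>

lemma proj_point_eq_iff:
  assumes "v \<noteq> 0" "w \<noteq> 0"
  shows "proj_point v = proj_point w \<longleftrightarrow> (\<exists>c. v = c *s w)"
proof
  assume "proj_point v = proj_point w"
  then have "vec.span {v} = vec.span {w}"
    using Rep_proj_point assms by metis
  then have "v \<in> vec.span {w}"
    using vec.span_base by blast
  then show "\<exists>c. v = c *s w"
    by (auto simp: vec.span_singleton)
next
  assume "\<exists>c. v = c *s w"
  then obtain c where "v = c *s w" "c \<noteq> 0"
    using assms by auto
  then have "vec.span {v} = vec.span {w}"
    using vec.span_image_scale[of "{w}" "\<lambda>_. c"] by simp
  then show "proj_point v = proj_point w"
    by (simp add: proj_point_def)
qed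

text \<open>Stated by coefficients for the ordered pair: unlike independence of the set
  \<open>{u, v}\<close>, it fails when \<open>u = v\<close>.\<close>

definition independent2 :: "'k :: field ^ 'n \<Rightarrow> 'k ^ 'n \<Rightarrow> bool" where
  "independent2 u v \<longleftrightarrow> (\<forall>a b. a *s u + b *s v = 0 \<longrightarrow> a = 0 \<and> b = 0)"

lemma independent2_nonzero: "independent2 u v \<Longrightarrow> u \<noteq> 0 \<and> v \<noteq> 0"
  unfolding independent2_def by (metis add.right_neutral add.left_neutral vec.scale_one vec.scale_zero_left zero_neq_one)

lemma span_pair: "vec.span {u, v} = {a *s u + b *s v | a b. True}"
  by (auto simp: vec.span_insert vec.span_singleton) (metis add.commute diff_eq_eq, metis add_diff_cancel_left')

lemma independent2_eqD:
  assumes "independent2 u v" "a *s u + b *s v = a' *s u + b' *s v"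
  shows "a = a' \<and> b = b'"
proof -
  have "(a - a') *s u + (b - b') *s v = 0"
    using assms(2) by (simp add: algebra_simps vec.scale_left_diff_distrib)
  then show ?thesis
    using assms(1) unfolding independent2_def by fastforce
qed

lemma independent2I:
  fixes u v :: "'k :: field ^ 'n :: finite"
  assumes "u \<noteq> 0" "v \<noteq> 0" "proj_point u \<noteq> proj_point v"
  shows "independent2 u v"
  unfolding independent2_def
proof safe
  fix a b assume *: "a *s u + b *s v = 0"
  show a: "a = 0"
  proof (rule ccontr)
    assume "a \<noteq> 0"
    have "u = inverse a *s (a *s u)"
      using \<open>a \<noteq> 0\<close> by simp
    also have "a *s u = (- b) *s v"
      using * by (simp add: eq_neg_iff_add_eq_0)
    finally show False
      using assms proj_point_eq_iff[of u v] by (metis vec.scale_scale)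
  qed
  then show "b = 0"
    using * assms by simp
qed

lemma dim_span_pair:
  assumes "independent2 u v"
  shows "vec.dim (vec.span {u, v}) = 2"
proof -
  have "u \<noteq> v"
    using independent2_eqD[OF assms, of 1 0 0 1] by auto
  moreover have "u \<notin> vec.span {v}"
  proof
    assume "u \<in> vec.span {v}"
    then obtain c where "u = c *s v"
      by (auto simp: vec.span_singleton)
    then show False
      using independent2_eqD[OF assms, of 1 0 0 c] by simp
  qed
  ultimately have "vec.independent {u, v}"
    using independent2_nonzero[OF assms] by (simp add: vec.independent_insert)
  then show ?thesis
    using \<open>u \<noteq> v\<close> by (simp add: vec.dim_span vec.dim_eq_card_independent)
qed

definition span_line :: "'k :: field ^ 'n :: finite \<Rightarrow> 'k ^ 'n \<Rightarrow> ('k, 'n) proj set" where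
  "span_line u v = {p. Rep_proj p \<subseteq> vec.span {u, v}}"

lemma proj_line_span_line: "independent2 u v \<Longrightarrow> proj_line (span_line u v)"
  unfolding linear_subvariety_def span_line_def
  using dim_span_pair by (intro exI[of _ "vec.span {u, v}"]) (simp add: numeral_2_eq_2 del: vec.dim_span)

lemma Rep_proj_subset_iff:
  assumes "v \<noteq> 0" "vec.subspace W"
  shows "Rep_proj (proj_point v) \<subseteq> W \<longleftrightarrow> v \<in> W"
  using assms by (auto simp: Rep_proj_point intro: vec.span_base vec.span_minimal[THEN subsetD])

lemma proj_point_in_span_line: "w \<noteq> 0 \<Longrightarrow> proj_point w \<in> span_line u v \<longleftrightarrow> (\<exists>a b. w = a *s u + b *s v)"
  by (simp add: span_line_def Rep_proj_subset_iff vec.subspace_span) (simp add: span_pair)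

lemma line_through_two_points:
  assumes "proj_line L" "independent2 u v" "proj_point u \<in> L" "proj_point v \<in> L"
  shows "L = span_line u v"
proof -
  obtain W where W: "vec.subspace W" "vec.dim W = 2" "L = {p. Rep_proj p \<subseteq> W}"
    using assms(1) by (auto simp: linear_subvariety_def)
  then have "u \<in> W" "v \<in> W"
    using assms independent2_nonzero[OF assms(2)] by (auto simp: Rep_proj_subset_iff)
  then have "vec.span {u, v} \<subseteq> W"
    using W by (intro vec.span_minimal) auto
  then have "vec.span {u, v} = W"
    using W dim_span_pair[OF assms(2)]
    by (intro vec.subspace_dim_equal) (auto simp del: vec.dim_span)
  then show ?thesis
    using W by (simp add: span_line_def)
qed

lemma rational_points_iff:
  "p \<in> rational_points \<longleftrightarrow> (\<exists>v. v \<noteq> 0 \<and> vfrob v = v \<and> p = proj_point v)"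
  by (auto simp: rational_points_def vfrob_eq_self_iff)

context finite_base_field
begin

text \<open>Coefficients in the rational basis \<open>u\<close>, \<open>v\<close> are unique, so a
  vector fixed by Frobenius has fixed coefficients. The points are therefore \<open>v\<close> and
  \<open>u + c v\<close> with \<open>c\<close> in the base field.\<close>

lemma card_rational_points_on_line:
  fixes u v :: "'f alg_closure ^ 'n :: finite"
  assumes ind: "independent2 u v" and rat: "vfrob u = u" "vfrob v = v"
  shows "card (span_line u v \<inter> rational_points) = CARD('f) + 1"
proof -
  define g where "g c = proj_point (u + to_ac c *s v)" for c
  have nz: "u + c *s v \<noteq> 0" for c
    using ind unfolding independent2_def by (metis vec.scale_one zero_neq_one)
  have v: "v \<noteq> 0"
    using independent2_nonzero[OF ind] by simp
  have "inj g"
  proof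
    fix c d assume "g c = g d"
    then obtain k where "u + to_ac c *s v = k *s (u + to_ac d *s v)"
      using nz proj_point_eq_iff unfolding g_def by blast
    then show "c = d"
      using independent2_eqD[OF ind, of 1 "to_ac c" k "k * to_ac d"] by (auto simp: vec.scale_right_distrib)
  qed
  moreover have "proj_point v \<notin> range g"
  proof
    assume "proj_point v \<in> range g"
    then obtain c k where "v = k *s (u + to_ac c *s v)"
      using nz proj_point_eq_iff v unfolding g_def by blast
    then show False
      using independent2_eqD[OF ind, of 0 1 k "k * to_ac c"] by (auto simp: vec.scale_right_distrib)
  qed
  moreover have "span_line u v \<inter> rational_points = insert (proj_point v) (range g)"
  proof (intro equalityI subsetI)
    fix p assume "p \<in> span_line u v \<inter> rational_points"
    then obtain w where w: "w \<noteq> 0" "vfrob w = w" "p = proj_point w" "proj_point w \<in> span_line u v"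
      by (auto simp: rational_points_iff)
    then obtain a b where ab: "w = a *s u + b *s v"
      by (auto simp: proj_point_in_span_line)
    then have "frob a *s u + frob b *s v = a *s u + b *s v"
      using w(2) rat by (simp add: vfrob_add vfrob_scale)
    then have "frob a = a" "frob b = b"
      using independent2_eqD[OF ind] by blast+
    then obtain a' b' where ab': "a = to_ac a'" "b = to_ac b'"
      by (auto simp: frob_eq_self_iff)
    show "p \<in> insert (proj_point v) (range g)"
    proof (cases "a = 0")
      case True
      then have "proj_point w = proj_point v"
        using proj_point_eq_iff[OF w(1) v] ab by auto
      then show ?thesis
        using w by simp
    next
      case False
      then have "w = a *s (u + to_ac (b' / a') *s v)"
        using ab ab' by (simp add: vec.scale_right_distrib)
      then have "proj_point w = g (b' / a')"
        unfolding g_def using proj_point_eq_iff[OF w(1) nz] by blast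
      then show ?thesis
        using w by simp
    qed
  next
    fix p assume "p \<in> insert (proj_point v) (range g)"
    then consider "p = proj_point v" | c where "p = proj_point (u + to_ac c *s v)"
      by (auto simp: g_def)
    then show "p \<in> span_line u v \<inter> rational_points"
    proof cases
      case 1
      have "v = 0 *s u + 1 *s v"
        by simp
      then show ?thesis
        using 1 v rat proj_point_in_span_line[OF v] rational_points_iff by blast
    next
      case 2
      have "vfrob (u + to_ac c *s v) = u + to_ac c *s v"
        using rat by (simp add: vfrob_add vfrob_scale)
      moreover have "u + to_ac c *s v = 1 *s u + to_ac c *s v"
        by simp
      ultimately show ?thesis
        using 2 nz proj_point_in_span_line[OF nz] rational_points_iff by blast
    qed
  qed
  ultimately show ?thesis
    by (simp add: card_image)
qed

text \<open>A line with two rational points is spanned by two rational vectors, and then the exact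
  count applies.\<close>

lemma card_rational_points_on_line_le:
  fixes L :: "('f alg_closure, 'n :: finite) proj set"
  assumes "proj_line L"
  shows "card (L \<inter> rational_points) \<le> CARD('f) + 1"
proof (cases "card (L \<inter> rational_points) \<le> 1")
  case False
  then obtain p p' where "p \<in> L \<inter> rational_points" "p' \<in> L \<inter> rational_points" "p \<noteq> p'"
    by (metis One_nat_def card_le_Suc0_iff_eq card.infinite zero_le)
  then obtain u v where uv: "u \<noteq> 0" "v \<noteq> 0" "vfrob u = u" "vfrob v = v" "proj_point u \<in> L" "proj_point v \<in> L"
    "proj_point u \<noteq> proj_point v"
    by (auto simp: rational_points_iff)
  then have "independent2 u v"
    by (intro independent2I)
  then have "L = span_line u v"
    using assms uv by (intro line_through_two_points)
  then show ?thesis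
    using card_rational_points_on_line[of u v] \<open>independent2 u v\<close> uv by simp
qed simp

end

section \<open>A regular spread\<close>

definition vec4 :: "'a \<Rightarrow> 'a \<Rightarrow> 'a \<Rightarrow> 'a \<Rightarrow> 'a ^ 4" where
  "vec4 x y z w = (\<chi> i. if i = 1 then x else if i = 2 then y else if i = 3 then z else w)"

lemma vec4_nth [simp]:
  "vec4 x y z w $ 1 = x" "vec4 x y z w $ 2 = y" "vec4 x y z w $ 3 = z" "vec4 x y z w $ 4 = w"
  by (simp_all add: vec4_def)

lemma vec4_eta: "v = vec4 (v $ 1) (v $ 2) (v $ 3) (v $ 4)"
  by (simp add: vec_eq_iff forall_4)

lemma vec4_eq_iff: "vec4 x y z w = vec4 x' y' z' w' \<longleftrightarrow> x = x' \<and> y = y' \<and> z = z' \<and> w = w'"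
  by (auto simp: vec_eq_iff forall_4)

lemma zero_vec4: "0 = vec4 0 0 0 0"
  by (simp add: vec_eq_iff forall_4)

lemma add_vec4: "vec4 x y z w + vec4 x' y' z' w' = vec4 (x + x') (y + y') (z + z') (w + w')"
  by (simp add: vec_eq_iff forall_4)

lemma scale_vec4: "c *s vec4 x y z w = vec4 (c * x) (c * y) (c * z) (c * w)"
  by (simp add: vec_eq_iff forall_4)

lemmas vec4_simps = vec4_eq_iff zero_vec4 add_vec4 scale_vec4

lemma vfrob_vec4: "vfrob (vec4 x y z w) = vec4 (frob x) (frob y) (frob z) (frob w)"
  by (simp add: vec_eq_iff forall_4 vfrob_def)

text \<open>The map takes the value 0 at both 0 and -1, so on a finite field it is not surjective.
  Unlike the choice of a nonsquare, this covers characteristic 2.\<close>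

lemma exists_irreducible_quadratic: "\<exists>c :: 'f :: {field, finite}. \<forall>x. x\<^sup>2 + x \<noteq> c"
proof -
  have "\<not> inj (\<lambda>x :: 'f. x\<^sup>2 + x)"
  proof
    assume "inj (\<lambda>x :: 'f. x\<^sup>2 + x)"
    from injD[OF this, of 0 "- 1"] show False
      by simp
  qed
  then have "\<not> surj (\<lambda>x :: 'f. x\<^sup>2 + x)"
    using finite_UNIV_surj_inj[OF finite] by blast
  then obtain c where "\<forall>x :: 'f. c \<noteq> x\<^sup>2 + x"
    unfolding surj_def by blast
  then show ?thesis
    by (intro exI[of _ c]) (simp add: eq_commute[of c])
qed

text \<open>The expression is the norm of \<open>x + y * omega\<close>, where
  \<open>omega ^ 2 + omega = c\<close>; a zero with \<open>y\<close> nonzero makes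
  \<open>- x / y\<close> a root of \<open>X ^ 2 + X - c\<close>.\<close>

lemma norm_form_anisotropic:
  fixes c :: "'f :: field"
  assumes c: "\<And>x. x\<^sup>2 + x \<noteq> c" and "x * (x - y) - c * y\<^sup>2 = 0"
  shows "x = 0 \<and> y = 0"
proof (cases "y = 0")
  case False
  have "x * (x - y) = c * y\<^sup>2"
    using assms(2) by simp
  then have "(- (x / y))\<^sup>2 + (- (x / y)) = c"
    using False by (simp add: field_simps power2_eq_square)
  then show ?thesis
    using c by blast
qed (use assms in auto)

text \<open>
  If \<open>X\<^sup>2 + X - c\<close> is irreducible with root \<open>\<omega>\<close>, these are the one-dimensional subspaces of
  \<open>F\<^sub>q(\<omega>)\<^sup>2\<close>, namely \<open>{(0, y)}\<close> and the graphs \<open>{(x, (m + n \<omega>) x)}\<close>, in the basis \<open>1, \<omega>\<close>.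
\<close>

fun spread_line :: "'f \<Rightarrow> ('f \<times> 'f) option \<Rightarrow> ('f :: field alg_closure, 4) proj set" where
  "spread_line c None = span_line (vec4 0 0 1 0) (vec4 0 0 0 1)"
| "spread_line c (Some (m, n)) =
     span_line (vec4 1 0 (to_ac m) (to_ac n)) (vec4 0 1 (to_ac (n * c)) (to_ac (m - n)))"

declare spread_line.simps [simp del]

text \<open>The second pair of equations says that \<open>v $ 3 + v $ 4 * omega\<close> is the
  product of \<open>m + n * omega\<close> and \<open>v $ 1 + v $ 2 * omega\<close>, expanded with
  \<open>omega ^ 2 = c - omega\<close>.\<close>

lemma in_spread_line:
  assumes "v \<noteq> 0"
  shows "proj_point v \<in> spread_line c None \<longleftrightarrow> v $ 1 = 0 \<and> v $ 2 = 0"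
    and "proj_point v \<in> spread_line c (Some (m, n)) \<longleftrightarrow>
      v $ 3 = to_ac m * v $ 1 + to_ac (n * c) * v $ 2 \<and> v $ 4 = to_ac n * v $ 1 + to_ac (m - n) * v $ 2"
proof -
  obtain x y z w where v: "v = vec4 x y z w"
    using vec4_eta by blast
  show "proj_point v \<in> spread_line c None \<longleftrightarrow> v $ 1 = 0 \<and> v $ 2 = 0"
    using assms by (simp add: spread_line.simps proj_point_in_span_line v vec4_simps)
  show "proj_point v \<in> spread_line c (Some (m, n)) \<longleftrightarrow>
      v $ 3 = to_ac m * v $ 1 + to_ac (n * c) * v $ 2 \<and> v $ 4 = to_ac n * v $ 1 + to_ac (m - n) * v $ 2"
    using assms by (simp add: spread_line.simps proj_point_in_span_line v vec4_simps mult.commute del: to_ac_mult to_ac_diff)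
qed

lemma spread_line_generators:
  fixes c :: "'f :: {field, finite}"
  obtains u v where "independent2 u v" "vfrob u = u" "vfrob v = v" "spread_line c k = span_line u v"
proof (cases k)
  case None
  show ?thesis
    by (rule that[of "vec4 0 0 1 0" "vec4 0 0 0 1"])
       (simp_all add: spread_line.simps None independent2_def vec4_simps vfrob_vec4)
next
  case (Some mn)
  obtain m n where mn: "mn = (m, n)"
    by fastforce
  show ?thesis
    by (rule that[of "vec4 1 0 (to_ac m) (to_ac n)" "vec4 0 1 (to_ac (n * c)) (to_ac (m - n))"])
       (simp_all add: spread_line.simps Some mn independent2_def vec4_simps vfrob_vec4 del: to_ac_mult to_ac_diff)
qed

lemma proj_cases:
  obtains v where "v \<noteq> 0" "p = proj_point v"
  by (metis Rep_proj_cases Rep_proj_point Rep_proj_inject)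

text \<open>Subtracting the equations of two graphs leaves a 2 by 2 linear system for the first two
  coordinates. Its determinant is the norm form at \<open>(m - m', n - n')\<close>, a nonzero
  element of the base field, so the lines stay disjoint over the closure.\<close>

lemma spread_line_disjoint:
  fixes c :: "'f :: field"
  assumes c: "\<And>x. x\<^sup>2 + x \<noteq> c" and "k \<noteq> k'"
  shows "spread_line c k \<inter> spread_line c k' = {}"
proof -
  have 1: False if "v \<noteq> 0" "proj_point v \<in> spread_line c None" "proj_point v \<in> spread_line c (Some mn)" for v mn
    using that by (cases mn) (auto simp: in_spread_line vec_eq_iff forall_4)
  have 2: False if v: "v \<noteq> 0" "proj_point v \<in> spread_line c (Some (m, n))"
    "proj_point v \<in> spread_line c (Some (m', n'))" and ne: "(m, n) \<noteq> (m', n')" for v m n m' n'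
  proof -
    let ?M = "to_ac (m - m')" and ?N = "to_ac (n - n')"
    have "?M * v $ 1 + ?N * to_ac c * v $ 2 =
        (to_ac m * v $ 1 + to_ac (n * c) * v $ 2) - (to_ac m' * v $ 1 + to_ac (n' * c) * v $ 2)"
      "?N * v $ 1 + (?M - ?N) * v $ 2 =
        (to_ac n * v $ 1 + to_ac (m - n) * v $ 2) - (to_ac n' * v $ 1 + to_ac (m' - n') * v $ 2)"
      by (simp_all add: algebra_simps)
    moreover have "to_ac m * v $ 1 + to_ac (n * c) * v $ 2 = to_ac m' * v $ 1 + to_ac (n' * c) * v $ 2"
      "to_ac n * v $ 1 + to_ac (m - n) * v $ 2 = to_ac n' * v $ 1 + to_ac (m' - n') * v $ 2"
      using v(2,3) unfolding in_spread_line(2)[OF v(1)] by metis+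
    ultimately have *: "?M * v $ 1 + ?N * to_ac c * v $ 2 = 0" "?N * v $ 1 + (?M - ?N) * v $ 2 = 0"
      by simp_all
    \<comment> \<open>Cramer's rule for the system \<open>*\<close>.\<close>
    have "(?M * (?M - ?N) - to_ac c * ?N\<^sup>2) * v $ 1 =
        (?M - ?N) * (?M * v $ 1 + ?N * to_ac c * v $ 2) - ?N * to_ac c * (?N * v $ 1 + (?M - ?N) * v $ 2)"
      "(?M * (?M - ?N) - to_ac c * ?N\<^sup>2) * v $ 2 =
        ?M * (?N * v $ 1 + (?M - ?N) * v $ 2) - ?N * (?M * v $ 1 + ?N * to_ac c * v $ 2)"
      by (simp_all only: power2_eq_square left_diff_distrib right_diff_distrib distrib_left mult_ac) simp_all
    moreover have "?M * (?M - ?N) - to_ac c * ?N\<^sup>2 \<noteq> 0"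
    proof
      assume "?M * (?M - ?N) - to_ac c * ?N\<^sup>2 = 0"
      then have "to_ac ((m - m') * ((m - m') - (n - n')) - c * (n - n')\<^sup>2) = 0"
        by simp
      then have "(m - m') * ((m - m') - (n - n')) - c * (n - n')\<^sup>2 = 0"
        by (simp only: to_ac_eq_0_iff)
      then show False
        using norm_form_anisotropic[OF c] ne by fastforce
    qed
    ultimately have "v $ 1 = 0" "v $ 2 = 0"
      unfolding * by auto
    then show False
      using v by (auto simp: in_spread_line vec_eq_iff forall_4)
  qed
  show ?thesis
  proof (rule ccontr)
    assume "spread_line c k \<inter> spread_line c k' \<noteq> {}"
    then obtain p where "p \<in> spread_line c k" "p \<in> spread_line c k'"
      by blast
    moreover obtain v where "v \<noteq> 0" "p = proj_point v"
      by (rule proj_cases)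
    ultimately show False
      using 1 2 assms(2) by (cases k; cases k') (auto, metis+)
  qed
qed

lemma rational_point_in_spread_line:
  fixes c :: "'f :: {field, finite}"
  assumes c: "\<And>x. x\<^sup>2 + x \<noteq> c" and p: "p \<in> rational_points"
  shows "\<exists>k. p \<in> spread_line c k"
proof -
  obtain v where v: "v \<noteq> 0" "\<And>i. vec_nth v i \<in> range to_ac" "p = proj_point v"
    using p by (auto simp: rational_points_def)
  obtain x y z w where xyzw: "v $ 1 = to_ac x" "v $ 2 = to_ac y" "v $ 3 = to_ac z" "v $ 4 = to_ac w"
    using v(2)[of 1] v(2)[of 2] v(2)[of 3] v(2)[of 4] by blast
  show ?thesis
  proof (cases "x = 0 \<and> y = 0")
    case True
    then show ?thesis
      using v xyzw in_spread_line(1)[of v c] by auto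
  next
    case False
    \<comment> \<open>Here \<open>m + n * omega\<close> is the quotient of
      \<open>z + w * omega\<close> by \<open>x + y * omega\<close>, computed by multiplying with the
      conjugate of the divisor and dividing by its norm \<open>D\<close>.\<close>
    define D where "D = x * (x - y) - c * y\<^sup>2"
    have D: "D \<noteq> 0"
      using norm_form_anisotropic[OF c] False unfolding D_def by blast
    define m where "m = (z * (x - y) - w * (c * y)) / D"
    define n where "n = (x * w - y * z) / D"
    have Dm: "D * m = z * (x - y) - w * (c * y)" and Dn: "D * n = x * w - y * z"
      using D by (simp_all add: m_def n_def)
    have "D * (m * x + n * c * y) = (D * m) * x + (D * n) * c * y"
      "D * (n * x + (m - n) * y) = (D * n) * x + (D * m - D * n) * y"
      by (simp_all add: algebra_simps)
    then have "D * (m * x + n * c * y) = D * z" "D * (n * x + (m - n) * y) = D * w"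
      unfolding Dm Dn by (simp_all add: D_def algebra_simps power2_eq_square)
    then have "z = m * x + n * c * y" "w = n * x + (m - n) * y"
      using D by auto
    then have "p \<in> spread_line c (Some (m, n))"
      using v xyzw by (simp add: in_spread_line(2))
    then show ?thesis
      by blast
  qed
qed

context finite_base_field
begin

lemma spread:
  "\<exists>A :: ('f alg_closure, 4) proj set set. finite A \<and> card A = (CARD('f))\<^sup>2 + 1 \<and> (\<forall>L\<in>A. proj_line L) \<and>
     pairwise disjnt A \<and> rational_points \<subseteq> \<Union>A \<and> (\<forall>L\<in>A. card (L \<inter> rational_points) = CARD('f) + 1)"
proof -
  obtain c :: 'f where c: "\<And>x. x\<^sup>2 + x \<noteq> c"
    using exists_irreducible_quadratic by blast
  have card: "card (spread_line c k \<inter> rational_points) = CARD('f) + 1" for k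
    using spread_line_generators[of c k] card_rational_points_on_line by metis
  have disj: "disjnt (spread_line c k) (spread_line c k')" if "k \<noteq> k'" for k k'
    using spread_line_disjoint[OF c that] by (simp add: disjnt_def)
  have "inj (spread_line c)"
  proof
    fix k k' assume "spread_line c k = spread_line c k'"
    moreover have "spread_line c k \<noteq> {}"
      using card[of k] by auto
    ultimately show "k = k'"
      using disj by (metis disjnt_self_iff_empty)
  qed
  then have "card (range (spread_line c)) = CARD(('f \<times> 'f) option)"
    by (rule card_image)
  also have "\<dots> = (CARD('f))\<^sup>2 + 1"
    by (simp add: card_option power2_eq_square)
  finally have "card (range (spread_line c)) = (CARD('f))\<^sup>2 + 1" .
  moreover have "proj_line (spread_line c k)" for k
    using spread_line_generators[of c k] proj_line_span_line by metis
  moreover have "pairwise disjnt (range (spread_line c))"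
    by (rule pairwise_imageI) (rule disj)
  moreover have "rational_points \<subseteq> \<Union>(range (spread_line c))"
    using rational_point_in_spread_line[OF c] by blast
  ultimately show ?thesis
    using card by (intro exI[of _ "range (spread_line c)"]) auto
qed

text \<open>The points are counted along the spread: disjoint lines, q^2 + 1 in number, carry q + 1
  points each.\<close>

lemma finite_card_rational_points:
  "finite (rational_points :: ('f alg_closure, 4) proj set)"
  "card (rational_points :: ('f alg_closure, 4) proj set) = ((CARD('f))\<^sup>2 + 1) * (CARD('f) + 1)"
proof -
  let ?Z = "rational_points :: ('f alg_closure, 4) proj set"
  obtain A :: "('f alg_closure, 4) proj set set" where A: "finite A" "card A = (CARD('f))\<^sup>2 + 1"
    "pairwise disjnt A" "?Z \<subseteq> \<Union>A" "\<And>L. L \<in> A \<Longrightarrow> card (L \<inter> ?Z) = CARD('f) + 1"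
    using spread by blast
  \<comment> \<open>An infinite set would have cardinality 0, not q + 1.\<close>
  have fin: "finite (L \<inter> ?Z)" if "L \<in> A" for L
    using A(5)[OF that] by (metis card.infinite add_is_0 one_neq_zero)
  have Z: "?Z = (\<Union>L\<in>A. L \<inter> ?Z)"
    using A(4) by blast
  show "finite ?Z"
    by (subst Z) (rule finite_UN_I[OF A(1) fin])
  have "card (\<Union>L\<in>A. L \<inter> ?Z) = (\<Sum>L\<in>A. card (L \<inter> ?Z))"
    using A fin by (intro card_UN_disjoint) (auto simp: pairwise_def disjnt_def)
  then show "card ?Z = ((CARD('f))\<^sup>2 + 1) * (CARD('f) + 1)"
    using Z A by simp
qed

section \<open>Nontriviality of the set of rational points\<close>

lemma rational_points_not_in_plane:
  assumes "proj_plane H"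
  shows "\<not> (rational_points :: ('f alg_closure, 4) proj set) \<subseteq> H"
proof
  assume sub: "(rational_points :: ('f alg_closure, 4) proj set) \<subseteq> H"
  obtain W :: "('f alg_closure ^ 4) set" where W: "vec.subspace W" "vec.dim W = 3" "H = {p. Rep_proj p \<subseteq> W}"
    using assms by (auto simp: linear_subvariety_def)
  have "axis i 1 \<in> W" for i
  proof -
    have "vfrob (axis i 1 :: 'f alg_closure ^ 4) = axis i 1"
      by (simp add: vfrob_def vec_eq_iff axis_def)
    moreover have nz: "(axis i 1 :: 'f alg_closure ^ 4) \<noteq> 0"
      by (simp add: axis_eq_0_iff)
    ultimately have "proj_point (axis i 1) \<in> H"
      using sub rational_points_iff by blast
    then show ?thesis
      using W nz by (simp add: Rep_proj_subset_iff)
  qed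
  then have "cart_basis \<subseteq> W"
    by (auto simp: cart_basis_def)
  then have "vec.span cart_basis \<subseteq> W"
    using W by (intro vec.span_minimal)
  then have "W = UNIV"
    using vec.span_Basis by auto
  then have "vec.dim W = 4"
    by (simp add: vec.dim_UNIV vec.dimension_def card_cart_basis)
  then show False
    using W by simp
qed

text \<open>The disjoint lines of \<open>A\<close> meet one fixed line \<open>M\<close> of
  \<open>B\<close> in different rational points, so there are at most q + 1 of them. They cover the
  set, which would leave it at most (q + 1)^2 points.\<close>

lemma rational_points_not_grid: "\<not> is_grid a b (rational_points :: ('f alg_closure, 4) proj set)"
proof
  let ?Z = "rational_points :: ('f alg_closure, 4) proj set" and ?q = "CARD('f)"
  assume "is_grid a b ?Z"
  then obtain A B where A: "finite A" "\<forall>L\<in>A. proj_line L" "pairwise disjnt A"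
    and B: "finite B" "\<forall>M\<in>B. proj_line M" "pairwise disjnt B"
    and meet: "\<forall>L\<in>A. \<forall>M\<in>B. \<exists>p. L \<inter> M = {p}" and Z: "?Z = (\<Union>L\<in>A. \<Union>M\<in>B. L \<inter> M)"
    by (auto simp: is_grid_def)
  have "card ?Z > 0"
    by (simp add: finite_card_rational_points)
  then obtain M where M: "M \<in> B"
    using Z by fastforce
  have "\<forall>L\<in>A. \<exists>p. L \<inter> M = {p}"
    using meet M by blast
  from bchoice[OF this] obtain g where g: "\<And>L. L \<in> A \<Longrightarrow> L \<inter> M = {g L}"
    by blast
  have "inj_on g A"
  proof
    fix L L' assume L: "L \<in> A" "L' \<in> A" "g L = g L'"
    then have "\<not> disjnt L L'"
      using g unfolding disjnt_def by blast
    then show "L = L'"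
      using A(3) L by (auto simp: pairwise_def)
  qed
  moreover have "g ` A \<subseteq> M \<inter> ?Z"
  proof
    fix p assume "p \<in> g ` A"
    then obtain L where "L \<in> A" "p \<in> L \<inter> M"
      using g by blast
    then show "p \<in> M \<inter> ?Z"
      using Z M by blast
  qed
  ultimately have "card A \<le> card (M \<inter> ?Z)"
    using finite_card_rational_points by (metis card_inj_on_le finite_Int)
  also have "\<dots> \<le> ?q + 1"
    using B M by (intro card_rational_points_on_line_le) auto
  finally have card_A: "card A \<le> ?q + 1" .
  have "?Z = (\<Union>L\<in>A. L \<inter> ?Z)"
    using Z by blast
  then have "card ?Z \<le> (\<Sum>L\<in>A. card (L \<inter> ?Z))"
    using card_UN_le[OF A(1), of "\<lambda>L. L \<inter> ?Z"] by simp
  also have "\<dots> \<le> (\<Sum>L\<in>A. ?q + 1)"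
    using A by (intro sum_mono card_rational_points_on_line_le) auto
  also have "\<dots> = card A * (?q + 1)"
    by simp
  also have "\<dots> \<le> (?q + 1) * (?q + 1)"
    by (rule mult_le_mono1[OF card_A])
  finally have "?q\<^sup>2 + 1 \<le> ?q + 1"
    by (simp only: finite_card_rational_points mult_le_cancel2)
  moreover have "2 * ?q \<le> ?q\<^sup>2"
    using CARD_field_ge_2[where ?'f = 'f] by (simp add: power2_eq_square)
  ultimately show False
    using CARD_field_ge_2[where ?'f = 'f] by linarith
qed

lemma rational_points_nontrivial: "\<not> trivial_config (rational_points :: ('f alg_closure, 4) proj set)"
  using rational_points_not_in_plane rational_points_not_grid unfolding trivial_config_def by blast

end

section \<open>Projection from a general point\<close>

definition row_form :: "'k :: field ^ 'n ^ 'm \<Rightarrow> 'm \<Rightarrow> ('k, 'n :: finite) mpoly" where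
  "row_form A j = (\<Sum>i\<in>UNIV. mconst (A $ j $ i) * mvar i)"

lemma eval_row_form: "eval_mpoly (row_form A j) y = (A *v y) $ j"
  by (simp add: row_form_def eval_mpoly_simps matrix_vector_mult_def)

lemma homogeneous_row_form: "homogeneous 1 (row_form A j)"
  unfolding row_form_def by (intro homogeneous_sum homogeneous_mconst_mult homogeneous_mvar)

text \<open>The inverse matrix expresses the variables through the rows and produces vectors with
  prescribed values.\<close>

lemma linear_coordinates_row_form:
  fixes A :: "'k :: alg_closed_field ^ 3 ^ 3"
  assumes "invertible A"
  shows "linear_coordinates (row_form A 1) (row_form A 2) (row_form A 3)"
proof
  obtain B where B: "A ** B = mat 1" "B ** A = mat 1"
    using assms invertible_def by blast
  show "homogeneous 1 (row_form A j)" "homogeneous 1 (row_form A j)" "homogeneous 1 (row_form A j)" for j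
    by (rule homogeneous_row_form)+
  show "\<exists>v. eval_mpoly (row_form A 1) v = x \<and> eval_mpoly (row_form A 2) v = y \<and> eval_mpoly (row_form A 3) v = z" for x y z
  proof (intro exI[of _ "B *v vector [x, y, z]"])
    have "A *v (B *v w) = w" for w
      by (simp add: matrix_vector_mul_assoc B)
    then show "eval_mpoly (row_form A 1) (B *v vector [x, y, z]) = x \<and>
        eval_mpoly (row_form A 2) (B *v vector [x, y, z]) = y \<and>
        eval_mpoly (row_form A 3) (B *v vector [x, y, z]) = z"
      by (simp add: eval_row_form)
  qed
  show "mvar i \<in> mp.span {row_form A 1, row_form A 2, row_form A 3}" for i
  proof -
    have row: "row_form A j \<in> {row_form A 1, row_form A 2, row_form A 3}" for j
      using exhaust_3[of j] by auto
    have "(\<Sum>j\<in>UNIV. mconst (B $ i $ j) * row_form A j) =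
        (\<Sum>j\<in>UNIV. \<Sum>k\<in>UNIV. mconst (B $ i $ j * A $ j $ k) * mvar k)"
      by (simp only: row_form_def sum_distrib_left mconst_mult mult.assoc)
    also have "\<dots> = (\<Sum>k\<in>UNIV. \<Sum>j\<in>UNIV. mconst (B $ i $ j * A $ j $ k) * mvar k)"
      by (rule sum.swap)
    also have "\<dots> = (\<Sum>k\<in>UNIV. mconst ((B ** A) $ i $ k) * mvar k)"
      by (simp only: matrix_matrix_mult_def vec_lambda_beta mconst_sum sum_distrib_right)
    also have "\<dots> = (\<Sum>k\<in>UNIV. if k = i then mvar k else 0)"
      unfolding B by (intro sum.cong) (auto simp: mat_def)
    also have "\<dots> = mvar i"
      by simp
    finally have "mvar i = (\<Sum>j\<in>UNIV. mconst (B $ i $ j) * row_form A j)" ..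
    also have "\<dots> \<in> mp.span {row_form A 1, row_form A 2, row_form A 3}"
      by (intro mp.span_sum mp.span_scale mp.span_base row)
    finally show ?thesis .
  qed
qed

section \<open>The Moore matrix and coordinates in the basis of conjugates\<close>

definition frob_exp :: "4 \<Rightarrow> nat" where
  "frob_exp j = (if j = 1 then 0 else if j = 2 then 1 else if j = 3 then 2 else 3)"

text \<open>The columns are \<open>v\<close> and its first three Frobenius conjugates. The exponents
  come from a case distinction because in the cyclic index type \<open>4\<close> the numeral 4
  equals 0.\<close>

definition moore :: "'f :: {field, finite} alg_closure ^ 4 \<Rightarrow> 'f alg_closure ^ 4 ^ 4" where
  "moore v = (\<chi> i j. (v $ i) ^ (CARD('f) ^ frob_exp j))"

lemma moore_frob:
  "moore v $ i $ 1 = v $ i" "moore v $ i $ 2 = frob (v $ i)"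
  "moore v $ i $ 3 = frob (frob (v $ i))" "moore v $ i $ 4 = frob (frob (frob (v $ i)))"
  by (simp_all add: moore_def frob_exp_def frob_def numeral_eq_Suc mult.assoc flip: power_mult)

locale general_point = finite_base_field F for F :: "'f :: {field, finite} itself" +
  fixes v :: "'f alg_closure ^ 4"
  assumes det_moore: "det (moore v) \<noteq> 0"
begin

abbreviation "v1 \<equiv> vfrob v"
abbreviation "v2 \<equiv> vfrob v1"
abbreviation "v3 \<equiv> vfrob v2"

text \<open>Coordinates in the basis \<open>v\<close>, \<open>v1\<close>, \<open>v2\<close>,
  \<open>v3\<close> formed by the columns of the Moore matrix.\<close>

definition co :: "'f alg_closure ^ 4 \<Rightarrow> 'f alg_closure ^ 4" where
  "co x = matrix_inv (moore v) *v x"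

lemma moore_mult: "moore v *v vec4 a s t r = a *s v + s *s v1 + t *s v2 + r *s v3"
  by (simp add: vec_eq_iff matrix_vector_mult_def sum_4 moore_frob vfrob_def mult.commute)

lemma moore_inv: "matrix_inv (moore v) ** moore v = mat 1" "moore v ** matrix_inv (moore v) = mat 1"
proof -
  have "\<exists>B. moore v ** B = mat 1 \<and> B ** moore v = mat 1"
    using det_moore by (simp flip: invertible_det_nz invertible_def)
  from someI_ex[OF this] show "matrix_inv (moore v) ** moore v = mat 1" "moore v ** matrix_inv (moore v) = mat 1"
    by (simp_all add: matrix_inv_def)
qed

lemma co_comb [simp]: "co (a *s v + s *s v1 + t *s v2 + r *s v3) = vec4 a s t r"
  by (simp add: co_def matrix_vector_mul_assoc moore_inv flip: moore_mult)

lemma co_add: "co (x + y) = co x + co y"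
  and co_diff: "co (x - y) = co x - co y"
  and co_scale: "co (c *s x) = c *s co x"
  by (simp_all add: co_def matrix_vector_right_distrib matrix_vector_mult_diff_distrib vec.scale)

lemma expand: "x = co x $ 1 *s v + co x $ 2 *s v1 + co x $ 3 *s v2 + co x $ 4 *s v3"
proof -
  have "x = moore v *v co x"
    by (simp add: co_def matrix_vector_mul_assoc moore_inv)
  then show ?thesis
    by (metis moore_mult vec4_eta)
qed

lemma co_inj: "co x = co y \<Longrightarrow> x = y"
  by (metis expand)

lemma co_v: "co v = vec4 1 0 0 0" and co_v1: "co v1 = vec4 0 1 0 0"
  using co_comb[of 1 0 0 0] co_comb[of 0 1 0 0] by simp_all

text \<open>The four constants express the next conjugate: \<open>vfrob v3 = \<alpha> *s v + \<beta>
  *s v1 + \<gamma> *s v2 + \<delta> *s v3\<close>.\<close>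

definition "\<alpha> = co (vfrob v3) $ 1"
definition "\<beta> = co (vfrob v3) $ 2"
definition "\<gamma> = co (vfrob v3) $ 3"
definition "\<delta> = co (vfrob v3) $ 4"

text \<open>Frobenius is semilinear and shifts the basis by one place, the last vector being sent to
  the combination with coefficients \<alpha>, \<beta>, \<gamma>, \<delta>. Comparing coordinates of
  \<open>z\<close> and \<open>vfrob z\<close> gives the recursion.\<close>

lemma rational_coordinates:
  assumes "vfrob z = z"
  shows "co z $ 1 = \<alpha> * frob (co z $ 4)"
    and "co z $ 2 = frob (co z $ 1) + \<beta> * frob (co z $ 4)"
    and "co z $ 3 = frob (co z $ 2) + \<gamma> * frob (co z $ 4)"
    and "co z $ 4 = frob (co z $ 3) + \<delta> * frob (co z $ 4)"
proof -
  let ?a = "frob (co z $ 1)" and ?s = "frob (co z $ 2)" and ?t = "frob (co z $ 3)" and ?r = "frob (co z $ 4)"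
  have "z = vfrob (co z $ 1 *s v + co z $ 2 *s v1 + co z $ 3 *s v2 + co z $ 4 *s v3)"
    using assms expand[of z] by simp
  also have "\<dots> = ?a *s v1 + ?s *s v2 + ?t *s v3 + ?r *s vfrob v3"
    by (simp add: vfrob_add vfrob_scale)
  also have "\<dots> = ?a *s v1 + ?s *s v2 + ?t *s v3 + ?r *s (\<alpha> *s v + \<beta> *s v1 + \<gamma> *s v2 + \<delta> *s v3)"
    unfolding \<alpha>_def \<beta>_def \<gamma>_def \<delta>_def by (simp flip: expand)
  also have "\<dots> = (\<alpha> * ?r) *s v + (?a + \<beta> * ?r) *s v1 + (?s + \<gamma> * ?r) *s v2 + (?t + \<delta> * ?r) *s v3"
    by (simp add: vec_eq_iff algebra_simps)
  finally have "co z = vec4 (\<alpha> * ?r) (?a + \<beta> * ?r) (?s + \<gamma> * ?r) (?t + \<delta> * ?r)"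
    by (metis co_comb)
  from arg_cong[OF this, of "\<lambda>x. x $ 1"] arg_cong[OF this, of "\<lambda>x. x $ 2"]
    arg_cong[OF this, of "\<lambda>x. x $ 3"] arg_cong[OF this, of "\<lambda>x. x $ 4"]
  show "co z $ 1 = \<alpha> * ?r" "co z $ 2 = ?a + \<beta> * ?r" "co z $ 3 = ?s + \<gamma> * ?r" "co z $ 4 = ?t + \<delta> * ?r"
    by simp_all
qed

text \<open>If the last coordinate is 0, the recursion makes the first one 0, then the second and
  then the third. Hence no projected point lies on the line \<open>r = 0\<close>.\<close>

lemma rational_last_nonzero:
  assumes z: "vfrob z = z" "z \<noteq> 0"
  shows "co z $ 4 \<noteq> 0"
proof
  assume "co z $ 4 = 0"
  moreover from this have "co z $ 1 = 0"
    using rational_coordinates(1)[OF z(1)] by simp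
  moreover from calculation have "co z $ 2 = 0"
    using rational_coordinates(2)[OF z(1)] by simp
  moreover from calculation have "co z $ 3 = 0"
    using rational_coordinates(3)[OF z(1)] by simp
  ultimately have "z = 0"
    using expand[of z] by simp
  then show False
    using z by simp
qed

text \<open>This gives injectivity of the projection on rational points. The fourth equation of the
  recursion and the nonzero last coordinate force \<open>frob l = l\<close>; the first equation then
  recovers the coordinate along \<open>v\<close>, which the projection forgets.\<close>

lemma rational_proportional:
  assumes z: "vfrob z = z" "z \<noteq> 0" and z': "vfrob z' = z'" "z' \<noteq> 0"
    and l: "co z $ 3 = l * co z' $ 3" "co z $ 4 = l * co z' $ 4" "co z $ 2 = l * co z' $ 2"
  shows "z = l *s z'"
proof -
  have "l * co z' $ 4 = frob l * (frob (co z' $ 3) + \<delta> * frob (co z' $ 4))"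
    using rational_coordinates(4)[OF z(1)] l by (simp add: frob_mult algebra_simps)
  also have "\<dots> = frob l * co z' $ 4"
    using rational_coordinates(4)[OF z'(1)] by simp
  finally have "frob l = l"
    using rational_last_nonzero[OF z'] by simp
  then have "co z $ 1 = l * co z' $ 1"
    using rational_coordinates(1)[OF z(1)] rational_coordinates(1)[OF z'(1)] l by (simp add: frob_mult)
  then have "co z = l *s co z'"
    using l by (simp add: vec_eq_iff forall_4)
  then show ?thesis
    by (metis co_inj co_scale)
qed

text \<open>If s'', t'', r'' are the images of the coordinates of a rational point under two
  applications of \<open>frob\<close>, iterating the recursion gives s = \<beta> t'' + \<epsilon>
  r'' and r = s'' + \<delta> t'' + \<zeta> r''.\<close>

definition "\<epsilon> = frob \<alpha> + frob \<delta> * \<beta>"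
definition "\<zeta> = frob \<gamma> + frob \<delta> * \<delta>"

text \<open>
  The cones \<open>det (x\<^sup>q, x, v, v\<^sup>q) = 0\<close> and \<open>det (x\<^sup>Q, x, v, v\<^sup>Q) = 0\<close>, \<open>Q = q\<^sup>2\<close>, with vertex \<open>v\<close>
  contain every rational point; these are their equations in the coordinates of \<open>x\<close>.
\<close>

lemma rational_equations:
  assumes z: "vfrob z = z"
  defines "s \<equiv> co z $ 2" and "t \<equiv> co z $ 3" and "r \<equiv> co z $ 4"
  shows "t * frob t + \<delta> * frob r * t - r * frob s - \<gamma> * r * frob r = 0"
    and "s * frob (frob s) + \<delta> * s * frob (frob t) + \<zeta> * s * frob (frob r) -
      \<beta> * r * frob (frob t) - \<epsilon> * r * frob (frob r) = 0"
proof -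
  note eq = rational_coordinates[OF z, folded s_def t_def r_def]
  \<comment> \<open>This is \<open>t * r - r * t = 0\<close> with the second factor of each product
    rewritten by the recursion. The other equation arises in the same way from
    \<open>s * r - r * s = 0\<close>, with the recursion applied twice.\<close>
  have "t * (frob t + \<delta> * frob r) - r * (frob s + \<gamma> * frob r) = 0"
    using eq(3,4) by (simp add: mult.commute)
  then show "t * frob t + \<delta> * frob r * t - r * frob s - \<gamma> * r * frob r = 0"
    by (simp add: algebra_simps)
  have fa: "frob (co z $ 1) = frob \<alpha> * frob (frob r)"
    using arg_cong[OF eq(1), of frob] by (simp add: frob_mult)
  have ft: "frob t = frob (frob s) + frob \<gamma> * frob (frob r)"
    using arg_cong[OF eq(3), of frob] by (simp add: frob_add frob_mult)
  have fr: "frob r = frob (frob t) + frob \<delta> * frob (frob r)"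
    using arg_cong[OF eq(4), of frob] by (simp add: frob_add frob_mult)
  have s: "s = frob \<alpha> * frob (frob r) + \<beta> * (frob (frob t) + frob \<delta> * frob (frob r))"
    by (rule trans[OF eq(2) arg_cong2[OF fa fr, of "\<lambda>x y. x + \<beta> * y"]])
  have r: "r = frob (frob s) + frob \<gamma> * frob (frob r) + \<delta> * (frob (frob t) + frob \<delta> * frob (frob r))"
    by (rule trans[OF eq(4) arg_cong2[OF ft fr, of "\<lambda>x y. x + \<delta> * y"]])
  have "s * (frob (frob s) + frob \<gamma> * frob (frob r) + \<delta> * (frob (frob t) + frob \<delta> * frob (frob r))) -
      r * (frob \<alpha> * frob (frob r) + \<beta> * (frob (frob t) + frob \<delta> * frob (frob r))) = 0"
    unfolding s[symmetric] r[symmetric] by (simp add: mult.commute)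
  then show "s * frob (frob s) + \<delta> * s * frob (frob t) + \<zeta> * s * frob (frob r) -
      \<beta> * r * frob (frob t) - \<epsilon> * r * frob (frob r) = 0"
    by (simp add: \<epsilon>_def \<zeta>_def algebra_simps)
qed

end

section \<open>Projection from the vertex to a plane\<close>

lemma frob_frob: "frob (frob x) = x ^ ((CARD('f))\<^sup>2)" for x :: "'f :: {field, finite} alg_closure"
  by (simp add: frob_def power2_eq_square flip: power_mult)

lemma Rep_proj_map:
  assumes "Vector_Spaces.linear (*s) (*s) \<phi>" "inj \<phi>" "y \<noteq> 0"
  shows "proj_map \<phi> (proj_point y) = proj_point (\<phi> y)" "\<phi> y \<noteq> 0"
proof -
  interpret Vector_Spaces.linear "(*s)" "(*s)" \<phi>
    by fact
  have "\<phi> ` vec.span {y} = vec.span {\<phi> y}"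
    by (simp add: vec.span_singleton image_image scale)
  then show "proj_map \<phi> (proj_point y) = proj_point (\<phi> y)"
    by (simp add: proj_map_def Rep_proj_point[OF assms(3)]) (simp add: proj_point_def)
  show "\<phi> y \<noteq> 0"
    using assms(2,3) zero by (metis injD)
qed

lemma proj_point_in_line_through:
  assumes "u \<noteq> 0" "v \<noteq> 0" "w \<noteq> 0"
  shows "proj_point w \<in> line_through (proj_point u) (proj_point v) \<longleftrightarrow> (\<exists>a b. w = a *s u + b *s v)"
proof -
  have "vec.span (vec.span {u} \<union> vec.span {v}) = vec.span {u, v}"
    by (simp only: insert_is_Un[of u "{v}"] vec.span_Un vec.span_span)
  then have "line_through (proj_point u) (proj_point v) = span_line u v"
    using assms by (simp add: line_through_def span_line_def Rep_proj_point)
  then show ?thesis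
    using assms by (simp add: proj_point_in_span_line)
qed

locale plane_projection = general_point F v for F :: "'f :: {field, finite} itself" and v +
  fixes \<phi> :: "'f alg_closure ^ 3 \<Rightarrow> 'f alg_closure ^ 4"
  assumes linear_\<phi>: "Vector_Spaces.linear (*s) (*s) \<phi>" and inj_\<phi>: "inj \<phi>"
    and vertex: "v \<notin> range \<phi>"
begin

text \<open>Dropping the coordinate along \<open>v\<close> is the linear projection with centre
  \<open>v\<close>.\<close>

definition co3 :: "'f alg_closure ^ 4 \<Rightarrow> 'f alg_closure ^ 3" where
  "co3 x = vector [co x $ 2, co x $ 3, co x $ 4]"

lemma co3_nth [simp]: "co3 x $ 1 = co x $ 2" "co3 x $ 2 = co x $ 3" "co3 x $ 3 = co x $ 4"
  by (simp_all add: co3_def)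

lemma co3_add: "co3 (x + y) = co3 x + co3 y"
  and co3_diff: "co3 (x - y) = co3 x - co3 y"
  and co3_scale: "co3 (c *s x) = c *s co3 x"
  by (simp_all add: vec_eq_iff forall_3 co_add co_diff co_scale)

lemma co3_v [simp]: "co3 v = 0"
  by (simp add: vec_eq_iff forall_3 co_v)

lemma co3_eq_0D: "co3 x = 0 \<Longrightarrow> \<exists>c. x = c *s v"
  using expand[of x] by (auto simp: vec_eq_iff[of "co3 x"] forall_3)

text \<open>The change from the plane coordinates given by \<open>\<phi>\<close> to the coordinates
  \<open>s\<close>, \<open>t\<close>, \<open>r\<close>.\<close>

definition A :: "'f alg_closure ^ 3 ^ 3" where
  "A = matrix (\<lambda>y. co3 (\<phi> y))"

interpretation \<phi>: Vector_Spaces.linear "(*s)" "(*s)" \<phi>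
  by (rule linear_\<phi>)

lemma linear_co3_\<phi>: "Vector_Spaces.linear (*s) (*s) (\<lambda>y. co3 (\<phi> y))"
  unfolding Vector_Spaces.linear_iff
  by (simp add: vec.vector_space_axioms \<phi>.add \<phi>.scale co3_add co3_scale)

lemma A_mult: "A *v y = co3 (\<phi> y)"
  unfolding A_def by (rule matrix_works[OF linear_co3_\<phi>])

text \<open>A kernel vector is mapped by \<open>\<phi>\<close> to a multiple of \<open>v\<close>. As
  the image of \<open>\<phi>\<close> misses \<open>v\<close>, the multiple is 0, and injectivity
  finishes.\<close>

lemma invertible_A: "invertible A"
proof -
  have "y = 0" if y: "co3 (\<phi> y) = 0" for y
  proof -
    obtain c where c: "\<phi> y = c *s v"
      using co3_eq_0D[OF y] by blast
    have "c = 0"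
    proof (rule ccontr)
      assume "c \<noteq> 0"
      then have "\<phi> (inverse c *s y) = v"
        by (simp add: \<phi>.scale c)
      then show False
        using vertex by blast
    qed
    then have "\<phi> y = \<phi> 0"
      using c by (simp add: \<phi>.zero)
    then show ?thesis
      by (rule injD[OF inj_\<phi>])
  qed
  then show ?thesis
    unfolding invertible_left_inverse matrix_left_invertible_ker A_mult by blast
qed

text \<open>The vector of plane coordinates whose image under \<open>\<phi>\<close> agrees with
  \<open>z\<close> modulo \<open>v\<close>, that is, the projection of \<open>z\<close>.\<close>

definition \<Psi> :: "'f alg_closure ^ 4 \<Rightarrow> 'f alg_closure ^ 3" where
  "\<Psi> z = matrix_inv A *v co3 z"

lemma A_inv: "matrix_inv A ** A = mat 1" "A ** matrix_inv A = mat 1"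
proof -
  have "\<exists>B. A ** B = mat 1 \<and> B ** A = mat 1"
    using invertible_A by (simp add: invertible_def)
  from someI_ex[OF this] show "matrix_inv A ** A = mat 1" "A ** matrix_inv A = mat 1"
    by (simp_all add: matrix_inv_def)
qed

lemma A_\<Psi>: "A *v \<Psi> z = co3 z"
  by (simp add: \<Psi>_def matrix_vector_mul_assoc A_inv)

lemma \<Psi>_unique: "co3 (\<phi> y) = co3 z \<Longrightarrow> y = \<Psi> z"
  unfolding \<Psi>_def A_mult[symmetric] by (drule sym) (simp add: matrix_vector_mul_assoc A_inv)

lemma \<Psi>_scale: "\<Psi> (c *s z) = c *s \<Psi> z"
  by (simp add: \<Psi>_def co3_scale vec.scale)

lemma \<Psi>_nonzero: "vfrob z = z \<Longrightarrow> z \<noteq> 0 \<Longrightarrow> \<Psi> z \<noteq> 0"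
  using rational_last_nonzero[of z] A_\<Psi>[of z] by (auto simp: vec_eq_iff[of "0 :: _ ^ 3"] forall_3)

lemma \<Psi>_proportional:
  assumes "vfrob z = z" "z \<noteq> 0" "vfrob z' = z'" "z' \<noteq> 0" "\<Psi> z = l *s \<Psi> z'"
  shows "z = l *s z'"
proof (rule rational_proportional[OF assms(1-4)])
  have "co3 z = l *s co3 z'"
    using A_\<Psi>[of z] A_\<Psi>[of z'] by (simp add: assms(5) vec.scale)
  then show "co z $ 3 = l * co z' $ 3" "co z $ 4 = l * co z' $ 4" "co z $ 2 = l * co z' $ 2"
    by (simp_all add: vec_eq_iff forall_3)
qed

sublocale linear_coordinates "row_form A 1" "row_form A 2" "row_form A 3"
  by (rule linear_coordinates_row_form) (rule invertible_A)

abbreviation "s \<equiv> row_form A 1"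
abbreviation "t \<equiv> row_form A 2"
abbreviation "r \<equiv> row_form A 3"

text \<open>The two left sides in \<open>rational_equations\<close>, with \<open>frob\<close>
  written as a q-th power, are brought into the shape required by \<open>ci_equations\<close>:
  \<open>eqA\<close> and \<open>eqC\<close> collect the terms divisible by \<open>r\<close>, and
  \<open>eqB\<close> the remaining multiple of \<open>t ^ (q + 1)\<close>.\<close>

definition "eqA = mconst \<delta> * t * r ^ (CARD('f) - 1) - s ^ CARD('f) - mconst \<gamma> * r ^ CARD('f)"
definition "eqB = mconst \<delta> * s * t ^ ((CARD('f))\<^sup>2 - CARD('f) - 1)"
definition "eqC = mconst \<zeta> * s * r ^ ((CARD('f))\<^sup>2 - 1) - mconst \<beta> * t ^ ((CARD('f))\<^sup>2) - mconst \<epsilon> * r ^ ((CARD('f))\<^sup>2)"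

text \<open>The second bound makes \<open>q ^ 2 - q - 1\<close> a genuine exponent and puts the two
  degrees in order.\<close>

lemma q_bounds: "2 \<le> CARD('f)" "CARD('f) + 1 \<le> (CARD('f))\<^sup>2"
proof -
  show "2 \<le> CARD('f)"
    by (rule CARD_field_ge_2)
  then have "2 * CARD('f) \<le> (CARD('f))\<^sup>2"
    by (simp add: power2_eq_square)
  then show "CARD('f) + 1 \<le> (CARD('f))\<^sup>2"
    using \<open>2 \<le> CARD('f)\<close> by linarith
qed

lemma scaled_monomial_forms: "mconst c * s ^ i * t ^ j * r ^ k \<in> forms (i + j + k)"
  using forms_linear(3)[OF monomial_forms[of i j k, OF refl], of c] by (simp add: mult.assoc)

sublocale ci_equations s t r "CARD('f) + 1" "(CARD('f))\<^sup>2 + 1" eqA eqB eqC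
  "t ^ (CARD('f) + 1) + r * eqA" "s ^ ((CARD('f))\<^sup>2 + 1) + t ^ (CARD('f) + 1) * eqB + r * eqC"
proof unfold_locales
  have diff: "x - y \<in> forms d" if "x \<in> forms d" "y \<in> forms d" for x y d
    using that unfolding forms_def by (rule mp.span_diff)
  show "eqA \<in> forms (CARD('f) + 1 - 1)"
    using scaled_monomial_forms[of \<delta> 0 1 "CARD('f) - 1"] scaled_monomial_forms[of 1 "CARD('f)" 0 0] scaled_monomial_forms[of \<gamma> 0 0 "CARD('f)"] q_bounds
    unfolding eqA_def by (intro diff) simp_all
  have "1 + ((CARD('f))\<^sup>2 - CARD('f) - 1) + 0 = (CARD('f))\<^sup>2 + 1 - (CARD('f) + 1)"
    using q_bounds by linarith
  then show "eqB \<in> forms ((CARD('f))\<^sup>2 + 1 - (CARD('f) + 1))"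
    using scaled_monomial_forms[of \<delta> 1 "(CARD('f))\<^sup>2 - CARD('f) - 1" 0]
    by (simp only: eqB_def power_one_right power_0 mult_1_right)
  show "eqC \<in> forms ((CARD('f))\<^sup>2 + 1 - 1)"
    using scaled_monomial_forms[of \<zeta> 1 0 "(CARD('f))\<^sup>2 - 1"] scaled_monomial_forms[of \<beta> 0 "(CARD('f))\<^sup>2" 0] scaled_monomial_forms[of \<epsilon> 0 0 "(CARD('f))\<^sup>2"] q_bounds
    unfolding eqC_def by (intro diff) simp_all
qed (use q_bounds in auto)

lemma eval_equations:
  assumes "vfrob z = z"
  shows "eval_mpoly (t ^ (CARD('f) + 1) + r * eqA) (\<Psi> z) = 0"
    and "eval_mpoly (s ^ ((CARD('f))\<^sup>2 + 1) + t ^ (CARD('f) + 1) * eqB + r * eqC) (\<Psi> z) = 0"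
proof -
  let ?s = "co z $ 2" and ?t = "co z $ 3" and ?r = "co z $ 4"
  have ev: "eval_mpoly s (\<Psi> z) = ?s" "eval_mpoly t (\<Psi> z) = ?t" "eval_mpoly r (\<Psi> z) = ?r"
    by (simp_all add: eval_row_form A_\<Psi>)
  have pow: "x * x ^ (CARD('f) - 1) = frob x" "x * x ^ ((CARD('f))\<^sup>2 - 1) = frob (frob x)"
    "x ^ (CARD('f) + 1) * x ^ ((CARD('f))\<^sup>2 - CARD('f) - 1) = frob (frob x)" for x :: "'f alg_closure"
    using q_bounds unfolding frob_frob unfolding frob_def by (simp_all flip: power_Suc power_add)
  have "eval_mpoly (t ^ (CARD('f) + 1) + r * eqA) (\<Psi> z) =
      ?t * frob ?t + \<delta> * (?r * ?r ^ (CARD('f) - 1)) * ?t - ?r * frob ?s - \<gamma> * ?r * frob ?r"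
    by (simp add: eqA_def eval_mpoly_simps ev frob_def algebra_simps)
  then show "eval_mpoly (t ^ (CARD('f) + 1) + r * eqA) (\<Psi> z) = 0"
    unfolding pow using rational_equations(1)[OF assms] by simp
  have "eval_mpoly (s ^ ((CARD('f))\<^sup>2 + 1) + t ^ (CARD('f) + 1) * eqB + r * eqC) (\<Psi> z) =
      ?s * frob (frob ?s) + \<delta> * ?s * (?t ^ (CARD('f) + 1) * ?t ^ ((CARD('f))\<^sup>2 - CARD('f) - 1)) + \<zeta> * ?s * (?r * ?r ^ ((CARD('f))\<^sup>2 - 1)) -
      \<beta> * ?r * frob (frob ?t) - \<epsilon> * ?r * frob (frob ?r)"
    by (simp add: eqB_def eqC_def eval_mpoly_simps ev frob_frob algebra_simps)
  then show "eval_mpoly (s ^ ((CARD('f))\<^sup>2 + 1) + t ^ (CARD('f) + 1) * eqB + r * eqC) (\<Psi> z) = 0"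
    unfolding pow using rational_equations(2)[OF assms] by simp
qed

text \<open>The kernel of \<open>co3\<close> consists of the multiples of \<open>v\<close>, so
  \<open>\<phi> y\<close> lies on the line joining \<open>v\<close> to a rational point exactly when
  \<open>y\<close> is proportional to the image of that point under \<open>\<Psi>\<close>. The
  function \<open>\<rho>\<close> picks representatives fixed by Frobenius.\<close>

lemma projection_rational_points:
  assumes \<rho>: "\<And>p. p \<in> rational_points \<Longrightarrow> \<rho> p \<noteq> 0 \<and> vfrob (\<rho> p) = \<rho> p \<and> p = proj_point (\<rho> p)"
    and H: "H = range (proj_map \<phi>)"
  shows "proj_map \<phi> -` projection (proj_point v) H rational_points =
    (\<lambda>p. proj_point (\<Psi> (\<rho> p))) ` rational_points"
proof (intro equalityI subsetI)
  have v: "v \<noteq> 0"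
    using vertex \<phi>.zero by (metis rangeI)
  {
    fix p assume "p \<in> proj_map \<phi> -` projection (proj_point v) H rational_points"
    then obtain Q where Q: "Q \<in> rational_points" "proj_map \<phi> p \<in> line_through (proj_point v) Q"
      by (auto simp: projection_def)
    obtain y where y: "y \<noteq> 0" "p = proj_point y"
      by (rule proj_cases)
    note \<phi>y = Rep_proj_map[OF linear_\<phi> inj_\<phi> y(1)]
    obtain a b where "\<phi> y = a *s v + b *s \<rho> Q"
      using Q \<rho>[OF Q(1)] v \<phi>y proj_point_in_line_through[of v "\<rho> Q" "\<phi> y"] y by auto
    then have "co3 (\<phi> y) = co3 (b *s \<rho> Q)"
      by (simp add: co3_add co3_scale)
    then have "y = b *s \<Psi> (\<rho> Q)"
      using \<Psi>_unique \<Psi>_scale by metis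
    then have "p = proj_point (\<Psi> (\<rho> Q))"
      using y \<rho>[OF Q(1)] \<Psi>_nonzero proj_point_eq_iff by blast
    then show "p \<in> (\<lambda>p. proj_point (\<Psi> (\<rho> p))) ` rational_points"
      using Q by blast
  next
    fix p assume "p \<in> (\<lambda>p. proj_point (\<Psi> (\<rho> p))) ` rational_points"
    then obtain Q where Q: "Q \<in> rational_points" "p = proj_point (\<Psi> (\<rho> Q))"
      by blast
    let ?y = "\<Psi> (\<rho> Q)"
    have y: "?y \<noteq> 0"
      using \<rho>[OF Q(1)] \<Psi>_nonzero by blast
    note \<phi>y = Rep_proj_map[OF linear_\<phi> inj_\<phi> y]
    have "co3 (\<phi> ?y - \<rho> Q) = 0"
      using A_\<Psi>[of "\<rho> Q"] by (simp add: co3_diff A_mult)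
    then obtain a where "\<phi> ?y - \<rho> Q = a *s v"
      using co3_eq_0D by blast
    then have "\<phi> ?y = a *s v + 1 *s \<rho> Q"
      by (simp add: diff_eq_eq)
    then have "proj_point (\<phi> ?y) \<in> line_through (proj_point v) (proj_point (\<rho> Q))"
      using proj_point_in_line_through[of v "\<rho> Q" "\<phi> ?y"] v \<phi>y \<rho>[OF Q(1)] by blast
    then have "proj_map \<phi> p \<in> line_through (proj_point v) Q"
      using Q(2) \<phi>y \<rho>[OF Q(1)] by simp
    moreover have "proj_map \<phi> p \<in> H"
      unfolding H by (rule rangeI)
    ultimately have "proj_map \<phi> p \<in> line_through (proj_point v) Q \<inter> H"
      by blast
    then show "p \<in> proj_map \<phi> -` projection (proj_point v) H rational_points"
      using Q by (auto simp: projection_def)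
  }
qed

lemma projection_complete_intersection:
  assumes "H = range (proj_map \<phi>)"
  shows "complete_intersection (CARD('f) + 1) ((CARD('f))\<^sup>2 + 1)
    (proj_map \<phi> -` projection (proj_point v) H rational_points)"
proof -
  let ?Z = "rational_points :: ('f alg_closure, 4) proj set"
  have "\<forall>p\<in>?Z. \<exists>z. z \<noteq> 0 \<and> vfrob z = z \<and> p = proj_point z"
    by (simp add: rational_points_iff)
  from bchoice[OF this] obtain \<rho> where
    \<rho>: "\<And>p. p \<in> ?Z \<Longrightarrow> \<rho> p \<noteq> 0 \<and> vfrob (\<rho> p) = \<rho> p \<and> p = proj_point (\<rho> p)"
    by blast
  have nz: "\<Psi> (\<rho> p) \<noteq> 0" if "p \<in> ?Z" for p
    using \<rho>[OF that] \<Psi>_nonzero by blast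
  have "inj_on (\<lambda>p. proj_point (\<Psi> (\<rho> p))) ?Z"
  proof
    fix p p' assume p: "p \<in> ?Z" "p' \<in> ?Z" "proj_point (\<Psi> (\<rho> p)) = proj_point (\<Psi> (\<rho> p'))"
    then obtain l where "\<Psi> (\<rho> p) = l *s \<Psi> (\<rho> p')"
      using proj_point_eq_iff nz by blast
    then have "\<rho> p = l *s \<rho> p'"
      using \<Psi>_proportional \<rho>[OF p(1)] \<rho>[OF p(2)] by blast
    then have "proj_point (\<rho> p) = proj_point (\<rho> p')"
      using proj_point_eq_iff \<rho>[OF p(1)] \<rho>[OF p(2)] by blast
    then show "p = p'"
      using \<rho>[OF p(1)] \<rho>[OF p(2)] by simp
  qed
  then have "card ((\<lambda>p. proj_point (\<Psi> (\<rho> p))) ` ?Z) = (CARD('f) + 1) * ((CARD('f))\<^sup>2 + 1)"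
    by (simp only: card_image finite_card_rational_points mult.commute)
  moreover have "proj_map \<phi> -` projection (proj_point v) H ?Z = (\<lambda>p. proj_point (\<Psi> (\<rho> p))) ` ?Z"
    by (rule projection_rational_points[OF \<rho> assms])
  ultimately show ?thesis
  proof (elim ssubst, intro complete_intersection)
    fix p assume "p \<in> (\<lambda>p. proj_point (\<Psi> (\<rho> p))) ` ?Z"
    then obtain Q where Q: "Q \<in> ?Z" "p = proj_point (\<Psi> (\<rho> Q))"
      by blast
    have van: "vanishes_at f p \<longleftrightarrow> eval_mpoly f (\<Psi> (\<rho> Q)) = 0" if "homogeneous d f" for f d
      using vanishes_at_iff[OF that nz[OF Q(1)]] Rep_proj_point[OF nz[OF Q(1)]] Q by simp
    show "vanishes_at (t ^ (CARD('f) + 1) + r * eqA) p"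
      "vanishes_at (s ^ ((CARD('f))\<^sup>2 + 1) + t ^ (CARD('f) + 1) * eqB + r * eqC) p"
      using van[OF homogeneous_F] van[OF homogeneous_G] eval_equations \<rho>[OF Q(1)] by blast+
    show "\<not> vanishes_at r p"
      using van[OF homogeneous_row_form[of A 3]] rational_last_nonzero \<rho>[OF Q(1)] by (simp add: eval_row_form A_\<Psi>)
  qed (simp add: finite_card_rational_points)
qed

end

section \<open>The open set of vertices\<close>

text \<open>The Moore determinant as a form in the coordinates of the vertex; its nonvanishing
  defines the open set of admissible vertices.\<close>

definition moore_poly :: "('f :: {field, finite} alg_closure, 4) mpoly" where
  "moore_poly = det (\<chi> i j. mvar i ^ (CARD('f) ^ frob_exp j))"

lemma eval_moore_poly: "eval_mpoly moore_poly v = det (moore v)"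
proof -
  have sgn: "eval_mpoly (of_int (sign p)) v = of_int (sign p)" for p :: "4 \<Rightarrow> 4"
    by (cases "sign p = 1") (auto simp: eval_mpoly_simps sign_def)
  show ?thesis
    by (simp add: moore_poly_def moore_def det_def eval_mpoly_simps sgn)
qed

text \<open>Every term of the determinant takes one entry from each column, and the degree of an
  entry depends only on its column.\<close>

lemma homogeneous_moore_poly:
  "homogeneous (\<Sum>i\<in>UNIV. CARD('f) ^ frob_exp i) (moore_poly :: ('f :: {field, finite} alg_closure, 4) mpoly)"
  unfolding moore_poly_def det_def
proof (rule homogeneous_sum)
  let ?M = "(\<chi> i j. mvar i ^ (CARD('f) ^ frob_exp j)) :: ('f alg_closure, 4) mpoly ^ 4 ^ 4"
  fix p :: "4 \<Rightarrow> 4" assume "p \<in> {p. p permutes UNIV}"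
  then have p: "p permutes UNIV"
    by simp
  have "homogeneous (\<Sum>i\<in>UNIV. CARD('f) ^ frob_exp (p i)) (\<Prod>i\<in>UNIV. ?M $ i $ p i)"
    using homogeneous_power[OF homogeneous_mvar] by (intro homogeneous_prod) fastforce
  moreover have "(\<Sum>i\<in>UNIV. CARD('f) ^ frob_exp (p i)) = (\<Sum>i\<in>UNIV. CARD('f) ^ frob_exp i)"
    using sum.permute[OF p, of "\<lambda>i. CARD('f) ^ frob_exp i"] by (simp add: o_def)
  moreover have "homogeneous 0 (of_int (sign p) :: ('f alg_closure, 4) mpoly)"
    by (auto simp: sign_def homogeneous_1 homogeneous_uminus)
  ultimately show "homogeneous (\<Sum>i\<in>UNIV. CARD('f) ^ frob_exp i) (of_int (sign p) * (\<Prod>i\<in>UNIV. ?M $ i $ p i))"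
    using homogeneous_mult by fastforce
qed

context finite_base_field
begin

text \<open>At \<open>(1, x, x^2, x^3)\<close> the Moore matrix is a Vandermonde matrix in the
  conjugates of \<open>x\<close>. A kernel vector of its transpose is a polynomial of degree at most
  3 that vanishes at four distinct conjugates.\<close>

lemma exists_moore_nonzero: "\<exists>v :: 'f alg_closure ^ 4. det (moore v) \<noteq> 0"
proof -
  have "finite (\<Union>n\<in>{1, 2, 3 :: nat}. {x :: 'f alg_closure. x ^ (CARD('f) ^ n) = x})"
    using finite_roots_frobenius[where ?'f = 'f] by (intro finite_UN_I) auto
  then obtain x :: "'f alg_closure" where "x \<notin> (\<Union>n\<in>{1, 2, 3 :: nat}. {x. x ^ (CARD('f) ^ n) = x})"
    using infinite_alg_closed ex_new_if_finite by blast
  then have x: "frob x \<noteq> x" "frob (frob x) \<noteq> x" "frob (frob (frob x)) \<noteq> x"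
    by (auto simp: frob_def numeral_eq_Suc mult.assoc simp flip: power_mult)
  let ?v = "vec4 1 x (x ^ 2) (x ^ 3)"
  have "w = 0" if w: "transpose (moore ?v) *v w = 0" for w
  proof -
    let ?p = "[:w $ 1, w $ 2, w $ 3, w $ 4:]"
    have row: "(transpose (moore ?v) *v w) $ j =
        moore ?v $ 1 $ j * w $ 1 + moore ?v $ 2 $ j * w $ 2 + moore ?v $ 3 $ j * w $ 3 + moore ?v $ 4 $ j * w $ 4" for j
      by (simp add: matrix_vector_mult_def transpose_def sum_4)
    have "(transpose (moore ?v) *v w) $ 1 = poly ?p x"
      "(transpose (moore ?v) *v w) $ 2 = poly ?p (frob x)"
      "(transpose (moore ?v) *v w) $ 3 = poly ?p (frob (frob x))"
      "(transpose (moore ?v) *v w) $ 4 = poly ?p (frob (frob (frob x)))"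
      unfolding row moore_frob by (simp_all add: frob_mult algebra_simps power2_eq_square power3_eq_cube)
    then have roots: "{x, frob x, frob (frob x), frob (frob (frob x))} \<subseteq> {y. poly ?p y = 0}"
      using w by simp
    have four: "card {x, frob x, frob (frob x), frob (frob (frob x))} = 4"
      \<comment> \<open>Since \<open>frob\<close> is injective, any coincidence among the four
        conjugates reduces to \<open>x\<close> being fixed by one of the first three powers of
        Frobenius.\<close>
      using x by (auto simp: frob_eq_iff card_insert_if eq_commute[of x])
    have "?p = 0"
    proof (rule ccontr)
      assume nz: "?p \<noteq> 0"
      have "4 \<le> card {y. poly ?p y = 0}"
        using card_mono[OF poly_roots_finite[OF nz] roots] four by simp
      also have "\<dots> \<le> Polynomial.degree ?p"
        by (rule card_poly_roots_bound[OF nz])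
      also have "\<dots> \<le> 3"
        by simp
      finally show False
        by simp
    qed
    then show ?thesis
      by (simp add: vec_eq_iff forall_4)
  qed
  then have "invertible (transpose (moore ?v))"
    unfolding invertible_left_inverse matrix_left_invertible_ker by blast
  then have "det (moore ?v) \<noteq> 0"
    by (simp add: invertible_det_nz det_transpose)
  then show ?thesis
    by blast
qed

lemma general_projection:
  assumes v: "det (moore v) \<noteq> 0" "v \<noteq> 0" and P: "P = proj_point (v :: 'f alg_closure ^ 4)"
  shows "P \<notin> rational_points"
    and "P \<notin> H \<Longrightarrow> plane_coordinates H \<phi> \<Longrightarrow>
      complete_intersection (CARD('f) + 1) ((CARD('f))\<^sup>2 + 1) (proj_map \<phi> -` projection P H rational_points)"
proof -
  interpret general_point F v
    by standard (rule v)
  show "P \<notin> rational_points"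
  proof
    assume "P \<in> rational_points"
    then obtain z where z': "z \<noteq> 0" "vfrob z = z" "P = proj_point z"
      by (auto simp: rational_points_iff)
    then obtain c where z: "vfrob z = z" "v = c *s z"
      using P proj_point_eq_iff[OF v(2) z'(1)] by auto
    have "c \<noteq> 0"
      using z v by auto
    \<comment> \<open>For a rational vertex, \<open>vfrob v\<close> would be a multiple of
      \<open>v\<close>, although these are two vectors of a basis.\<close>
    then have "vfrob v = (frob c / c) *s v"
      using z by (simp add: vfrob_scale)
    then have "co (vfrob v) = (frob c / c) *s co v"
      by (simp only: co_scale)
    then show False
      by (simp add: co_v co_v1 vec4_simps)
  qed
  assume H: "P \<notin> H" "plane_coordinates H \<phi>"
  then have lin: "Vector_Spaces.linear (*s) (*s) \<phi>" and inj: "inj \<phi>" and range: "H = range (proj_map \<phi>)"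
    by (auto simp: plane_coordinates_def)
  have vertex: "v \<notin> range \<phi>"
  proof
    assume "v \<in> range \<phi>"
    then obtain y where y: "v = \<phi> y"
      by blast
    interpret Vector_Spaces.linear "(*s)" "(*s)" \<phi>
      by (rule lin)
    have "y \<noteq> 0"
      using y v zero by auto
    then have "P = proj_map \<phi> (proj_point y)"
      using Rep_proj_map(1)[OF lin inj] P y by simp
    then show False
      using H range by blast
  qed
  interpret plane_projection F v \<phi>
    by (intro plane_projection.intro plane_projection_axioms.intro general_point_axioms lin inj vertex)
  show "complete_intersection (CARD('f) + 1) ((CARD('f))\<^sup>2 + 1) (proj_map \<phi> -` projection P H rational_points)"
    unfolding P by (rule projection_complete_intersection[OF range])
qed

lemma geproci_rational_points:
  "geproci_unordered (CARD('f) + 1) ((CARD('f))\<^sup>2 + 1) (rational_points :: ('f alg_closure, 4) proj set)"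
proof -
  let ?D = "moore_poly :: ('f alg_closure, 4) mpoly"
  let ?U = "{P. \<not> vanishes_at ?D P}"
  have van: "vanishes_at ?D (proj_point v) \<longleftrightarrow> det (moore v) = 0" if "v \<noteq> 0" for v
    using vanishes_at_iff[OF homogeneous_moore_poly that Rep_proj_point[OF that]] by (simp add: eval_moore_poly)
  have "zariski_open ?U"
    unfolding zariski_open_def
    by (intro exI[of _ "{?D}"]) (use homogeneous_moore_poly[where ?'f = 'f] in auto)
  moreover have "?U \<noteq> {}"
  proof -
    obtain v :: "'f alg_closure ^ 4" where v: "det (moore v) \<noteq> 0"
      using exists_moore_nonzero by blast
    have "v \<noteq> 0"
    proof
      assume "v = 0"
      then have "row 1 (moore v) = 0"
        by (simp add: row_def moore_def vec_eq_iff power_0_left)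
      then show False
        using v det_zero_row(2) by blast
    qed
    then show ?thesis
      using v van by blast
  qed
  moreover have "P \<notin> rational_points \<and> (\<forall>H \<phi>. proj_plane H \<and> P \<notin> H \<and> plane_coordinates H \<phi> \<longrightarrow>
      complete_intersection (CARD('f) + 1) ((CARD('f))\<^sup>2 + 1) (proj_map \<phi> -` projection P H rational_points))"
    if "P \<in> ?U" for P
  proof -
    obtain v where v: "v \<noteq> 0" "P = proj_point v"
      by (rule proj_cases)
    then have "det (moore v) \<noteq> 0"
      using that van by auto
    then show ?thesis
      using general_projection v by blast
  qed
  ultimately show ?thesis
    unfolding geproci_unordered_def for_general_point_def
    by (auto simp: finite_card_rational_points)
qed

text \<open>The type of a half grid lists the number of lines first. The spread has q^2 + 1 lines
  with q + 1 points each, so the two degrees are exchanged.\<close>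

lemma half_grid_rational_points: "half_grid (rational_points :: ('f alg_closure, 4) proj set)"
proof -
  have "geproci_unordered ((CARD('f))\<^sup>2 + 1) (CARD('f) + 1) (rational_points :: ('f alg_closure, 4) proj set)"
    using geproci_rational_points complete_intersection_commute
    unfolding geproci_unordered_def for_general_point_def by meson
  then show ?thesis
    unfolding half_grid_def half_grid_of_type_def
    using rational_points_nontrivial spread by blast
qed

end

theorem theorem1:
  fixes q :: nat and Z :: "('f :: {field, finite} alg_closure, 4) proj set"
  assumes "primepow q"
    and "CARD('f) = q"
    and "Z = rational_points"
  shows "geproci (q + 1) (q\<^sup>2 + 1) Z \<and> half_grid Z"
proof -
  interpret finite_base_field "TYPE('f)"
    by standard (use assms in simp)
  have "q \<le> q\<^sup>2"
    by (simp add: power2_eq_square)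
  then show ?thesis
    using geproci_rational_points half_grid_rational_points assms by (simp add: geproci_def)
qed

end
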